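(* There is an absolute constant $C>0$ such that the following holds. Let $N\in\mathbb{N}$ be square-free. Then for every even integer $k\geq C\max\{1,\omega(N)\}$ and every integer $m$ with $1\leq m\leq \frac{1}{32\pi^2}N(k-1)^2$ and $\gcd(m,N)=1$, one has $v_\infty\left(P_{k,m,N}\right)\leq 2N$; in particular $P_{k,m,N}\not\equiv0$.
   Context: $\omega(N)$ denotes the number of distinct prime factors of $N$. For positive integers $k,m,N$ with $k$ even, $P_{k,m,N}$ denotes the Poincaré series of weight $k$ and index $m$ at the cusp $i\infty$ for $\Gamma_0(N)=\{\begin{pmatrix}a&b\\c&d\end{pmatrix}\in \mathrm{SL}_2(\mathbb{Z}) : N\mid c\}$: $$P_{k,m,N}(z)=\sum_{\gamma\in\Gamma_\infty\backslash\Gamma_0(N)} j(\gamma,z)^{-k} e(m\gamma z),$$ where $\Gamma_\infty=\{\begin{pmatrix}1&*\\0&1\end{pmatrix}\in\mathrm{SL}_2(\mathbb{Z})\}$, $j(\begin{pmatrix}a&b\\c&d\end{pmatrix},z)=cz+d$ and $e(z)=e^{2\pi i z}$. It has a Fourier expansion $P_{k,m,N}(z)=\sum_{n\geq1} p_{k,N}(m;n)e(nz)$, and $v_\infty(f)$ denotes the order of vanishing of $f$ at the cusp $i\infty$, i.e. the least $n\ge 1$ with nonzero $n$-th Fourier coefficient. *)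

theory Defs
  imports "HOL-Analysis.Analysis" "HOL-Computational_Algebra.Computational_Algebra"
begin

text \<open>Integer 2x2 matrices (a,b,c,d) = [[a,b],[c,d]].\<close>
type_synonym mat2 = "int \<times> int \<times> int \<times> int"

definition e :: "complex \<Rightarrow> complex" where
  "e z = exp (2 * of_real pi * \<i> * z)"

definition Gamma0 :: "nat \<Rightarrow> mat2 set" where
  "Gamma0 N = {(a,b,c,d). a*d - b*c = 1 \<and> int N dvd c}"

definition Gamma_inf :: "mat2 set" where
  "Gamma_inf = {(1,t,0,1) | t. True}"

definition mmult :: "mat2 \<Rightarrow> mat2 \<Rightarrow> mat2" where
  "mmult = (\<lambda>(a,b,c,d) (a',b',c',d'). (a*a'+b*c', a*b'+b*d', c*a'+d*c', c*b'+d*d'))"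

definition cosets :: "nat \<Rightarrow> mat2 set set" where
  "cosets N = (\<lambda>\<gamma>. (\<lambda>g. mmult g \<gamma>) ` Gamma_inf) ` Gamma0 N"

definition j_fac :: "mat2 \<Rightarrow> complex \<Rightarrow> complex" where
  "j_fac = (\<lambda>(a,b,c,d) z. of_int c * z + of_int d)"

definition moebius :: "mat2 \<Rightarrow> complex \<Rightarrow> complex" where
  "moebius = (\<lambda>(a,b,c,d) z. (of_int a * z + of_int b) / (of_int c * z + of_int d))"

text \<open>Summand of the Poincare series; it is independent of the coset representative.\<close>
definition poincare_term :: "nat \<Rightarrow> nat \<Rightarrow> mat2 \<Rightarrow> complex \<Rightarrow> complex" where
  "poincare_term k m \<gamma> z = j_fac \<gamma> z powi (- int k) * e (of_nat m * moebius \<gamma> z)"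

definition poincare :: "nat \<Rightarrow> nat \<Rightarrow> nat \<Rightarrow> complex \<Rightarrow> complex" where
  "poincare k m N z = (\<Sum>\<^sub>\<infinity>X\<in>cosets N. poincare_term k m (SOME \<gamma>. \<gamma> \<in> X) z)"

definition fourier_coeff :: "(complex \<Rightarrow> complex) \<Rightarrow> nat \<Rightarrow> complex" where
  "fourier_coeff f n = integral {0..1} (\<lambda>x::real. f (of_real x + \<i>) * e (- of_nat n * (of_real x + \<i>)))"

definition v_inf :: "(complex \<Rightarrow> complex) \<Rightarrow> nat" where
  "v_inf f = (LEAST n. n \<ge> 1 \<and> fourier_coeff f n \<noteq> 0)"

definition omega :: "nat \<Rightarrow> nat" where
  "omega N = card (prime_factors N)"

end

theory Submission
  imports
    "HOL-Complex_Analysis.Complex_Analysis"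
    "HOL-Real_Asymp.Real_Asymp"
    "HOL-Number_Theory.Modular_Inverse"
    Defs
begin

text \<open>
  Unfolding the series expresses the coefficient at an index \<open>n \<noteq> m\<close> as a nonzero constant times
  the sum over the moduli \<open>c = j N\<close>, \<open>j \<ge> 1\<close>, of
  \<open>S(m, n; c) / c * J(4 \<pi> sqrt (m n) / c)\<close>, where \<open>J\<close> is the Bessel function of order \<open>k - 1\<close>.
  For \<open>n = h N\<close> the Kloosterman sums lose their dependence on \<open>N\<close>: since \<open>m\<close> is coprime to the
  squarefree number \<open>N\<close>, \<open>S(m, h N; N)\<close> is the Ramanujan sum \<open>\<mu>(N) = \<plusminus>1\<close>, and
  \<open>S(m, h N; j N)\<close> is bounded by \<open>j\<close>. In the range \<open>m \<le> N (k - 1)\<^sup>2 / (32 \<pi>\<^sup>2)\<close> the Bessel value for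
  \<open>j = 1\<close> is within a factor \<open>exp (- 3 (k - 1) / 20)\<close> of the leading term of its power series, whereas
  passing to \<open>j \<ge> 2\<close> costs \<open>j ^ (1 - k)\<close>; hence the term \<open>j = 1\<close> dominates once \<open>k\<close> exceeds an
  absolute constant. One takes \<open>n = N\<close>, except for \<open>N = m = 1\<close>, where \<open>n = 2\<close> avoids the
  diagonal term.
\<close>

subsection \<open>The Bessel-Clifford function\<close>

text \<open>The obstacle is uniformity in N. Bounding S(m, n; j N) trivially by j N would lose a
  factor N against a main term whose Kloosterman sum has modulus 1, and k would have to grow with
  log N. For n = h N the phase carrying n is a character modulo j alone, so what remains is a sum
  over s modulo N, with a + j s coprime to N, that can be evaluated exactly. The same choice gives
  the modulus j N the Bessel argument T / j^2 with T = 4 pi^2 m h / N. For h = 1 the hypothesis on m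
  says exactly T <= (k - 1)^2 / 8, which explains 32 pi^2 = 8 * 4 pi^2. The divisor 8 is large
  enough for the three-term recurrence to keep the normalised ratios of consecutive orders below
  6/5. The resulting loss in the exponent is 6/5 * 1/8 = 3/20 per order, well under log 2, the gain
  per order in passing from j = 1 to j = 2.\<close>

text \<open>\<open>J\<^sub>\<nu>(x) = (x / 2) ^ \<nu> * bessel_clifford \<nu> (x\<^sup>2 / 4)\<close>; this normalisation is entire in \<open>t\<close>.\<close>

definition bessel_clifford :: "nat \<Rightarrow> 'a::{real_normed_field,banach} \<Rightarrow> 'a" where
  "bessel_clifford \<nu> t = (\<Sum>l. (- t) ^ l / (fact l * fact (\<nu> + l)))"

lemma summable_bessel_clifford:
  fixes t :: "'a::{real_normed_field,banach}"
  shows "summable (\<lambda>l. (- t) ^ l / (fact l * fact (\<nu> + l)))"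
proof (rule summable_comparison_test')
  show "summable (\<lambda>l. norm t ^ l /\<^sub>R fact l)"
    by (rule summable_exp_generic)
  fix l :: nat
  have "norm t ^ l / (fact l * fact (\<nu> + l)) \<le> norm t ^ l / (fact l * 1)"
    by (intro divide_left_mono mult_left_mono mult_pos_pos) (auto simp: fact_ge_1)
  then show "norm ((- t) ^ l / (fact l * fact (\<nu> + l))) \<le> norm t ^ l /\<^sub>R fact l"
    by (simp add: norm_divide norm_mult norm_power norm_inverse divide_inverse mult_ac)
qed

lemma bessel_clifford_0 [simp]: "bessel_clifford \<nu> 0 = 1 / fact \<nu>"
proof -
  have "(\<lambda>l. (- 0) ^ l / (fact l * fact (\<nu> + l)) :: 'a) = (\<lambda>l. if l = 0 then 1 / fact \<nu> else 0)"
    by (auto simp: fun_eq_iff)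
  then show ?thesis
    unfolding bessel_clifford_def using sums_single[of 0 "\<lambda>_. 1 / fact \<nu> :: 'a"]
    by (simp add: sums_iff)
qed

lemma bessel_clifford_of_real:
  "bessel_clifford \<nu> (of_real t :: 'a::{real_normed_field,banach}) = of_real (bessel_clifford \<nu> t)"
proof -
  have "(\<lambda>l. of_real ((- t) ^ l / (fact l * fact (\<nu> + l)))) sums (of_real (bessel_clifford \<nu> t) :: 'a)"
    unfolding bessel_clifford_def
    by (intro sums_of_real summable_sums summable_bessel_clifford)
  then show ?thesis
    by (simp add: bessel_clifford_def sums_iff)
qed

text \<open>Write 1 / (\<nu> + l)! = ((\<nu> + 1) + l) / (\<nu> + 1 + l)!. The summand l cancels
  against l! and shifts the index, which produces the order \<nu> + 2. For J this is the classical
  three-term recurrence.\<close>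

lemma bessel_clifford_rec:
  fixes t :: real
  shows "bessel_clifford \<nu> t =
    real (Suc \<nu>) * bessel_clifford (Suc \<nu>) t - t * bessel_clifford (Suc (Suc \<nu>)) t"
proof -
  let ?a = "\<lambda>\<mu> l. (- t) ^ l / (fact l * fact (\<mu> + l))"
  have s: "?a \<mu> sums bessel_clifford \<mu> t" for \<mu>
    unfolding bessel_clifford_def by (intro summable_sums summable_bessel_clifford)
  \<comment> \<open>The series of order \<nu> + 2 is delayed by one index, so that its extra factor
    t aligns the powers of t.\<close>
  let ?b = "\<lambda>l. case l of 0 \<Rightarrow> 0 | Suc l \<Rightarrow> t * ?a (Suc (Suc \<nu>)) l"
  have "(\<lambda>l. ?b (Suc l)) sums (t * bessel_clifford (Suc (Suc \<nu>)) t)"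
    using sums_mult[OF s[of "Suc (Suc \<nu>)"], of t] by simp
  then have "?b sums (t * bessel_clifford (Suc (Suc \<nu>)) t)"
    using sums_Suc_iff[of ?b "t * bessel_clifford (Suc (Suc \<nu>)) t"] by (simp del: fact_Suc)
  from sums_diff[OF sums_mult[OF s[of "Suc \<nu>"], of "real (Suc \<nu>)"] this]
  have "(\<lambda>l. real (Suc \<nu>) * ?a (Suc \<nu>) l - ?b l) sums
     (real (Suc \<nu>) * bessel_clifford (Suc \<nu>) t - t * bessel_clifford (Suc (Suc \<nu>)) t)" .
  moreover have "real (Suc \<nu>) * ?a (Suc \<nu>) l - ?b l = ?a \<nu> l" for l
  proof (cases l)
    case 0
    then show ?thesis by (simp add: field_simps del: of_nat_Suc)
  next
    case (Suc i)
    define x y q :: real where "x = fact i" and "y = fact (Suc (\<nu> + i))" and "q = real \<nu> + real i + 2"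
    have pos: "x > 0" "y > 0" "q > 0" "real i + 1 > 0"
      by (auto simp: x_def y_def q_def simp del: fact_Suc)
    have facts: "fact (Suc i) = (real i + 1) * x" "fact (Suc \<nu> + Suc i) = q * y"
        "fact (Suc (Suc \<nu>) + i) = q * y" "fact (\<nu> + Suc i) = y"
      by (simp_all add: x_def y_def q_def algebra_simps)
    have "(real \<nu> + 1) * (- t * w / ((real i + 1) * x * (q * y))) - t * (w / (x * (q * y))) =
        - t * w / ((real i + 1) * x * y)" for w
      using pos by (simp add: divide_simps) (simp add: q_def algebra_simps)
    from this[of "(- t) ^ i"] show ?thesis
      unfolding Suc facts x_def[symmetric] nat.case power_Suc of_nat_Suc by (simp add: add.commute)
  qed
  ultimately show ?thesis
    using s[of \<nu>] by (simp add: sums_unique2)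
qed

text \<open>Differentiation raises the order by one, so monotonicity in t becomes positivity at the
  next order.\<close>

lemma has_real_derivative_bessel_clifford:
  "(bessel_clifford \<nu> has_real_derivative - bessel_clifford (Suc \<nu>) t) (at t)"
proof -
  let ?c = "\<lambda>l. (- 1) ^ l / (fact l * fact (\<nu> + l)) :: real"
  have eq: "(- u) ^ l / (fact l * fact (\<nu> + l)) = ?c l * u ^ l" for u :: real and l
    by (subst power_minus) simp
  have sm: "summable (\<lambda>l. ?c l * u ^ l)" for u
    using summable_bessel_clifford[of u \<nu>] unfolding eq[of u] .
  have "((\<lambda>x. \<Sum>l. ?c l * x ^ l) has_field_derivative (\<Sum>l. diffs ?c l * t ^ l)) (at t)"
    by (rule termdiffs_strong_converges_everywhere) (rule sm)
  also have "(\<lambda>x. \<Sum>l. ?c l * x ^ l) = bessel_clifford \<nu>"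
    by (rule ext) (simp only: bessel_clifford_def eq[symmetric])
  also have "diffs ?c l * t ^ l = - ((- t) ^ l / (fact l * fact (Suc \<nu> + l)))" for l
  proof -
    define x y q :: real where "x = fact l" and "y = fact (\<nu> + Suc l)" and "q = real l + 1"
    have "fact (Suc l) = q * x" "fact (Suc \<nu> + l) = y" "q > 0"
      by (simp_all add: x_def y_def q_def algebra_simps)
    then show ?thesis
      unfolding diffs_def x_def[symmetric] y_def[symmetric]
      by (simp add: power_minus[of t] q_def add.commute del: fact_Suc)
  qed
  then have "(\<Sum>l. diffs ?c l * t ^ l) = - bessel_clifford (Suc \<nu>) t"
    unfolding bessel_clifford_def
    by (simp add: suminf_minus summable_bessel_clifford[where \<nu> = "Suc \<nu>", simplified])
  finally show ?thesis .
qed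

text \<open>Since \<mu>! / (\<mu> + l)! <= (\<mu> + 1)^(-l), the terms after the first are dominated
  by the exponential series of |t| / (\<mu> + 1), which tends to 0. This gives a starting point at
  high order for the descent below.\<close>

lemma fact_mult_bessel_clifford_tendsto: "(\<lambda>\<mu>. fact \<mu> * bessel_clifford \<mu> t) \<longlonglongrightarrow> (1::real)"
proof -
  have bound: "norm (fact \<mu> * bessel_clifford \<mu> t - 1) \<le> exp (\<bar>t\<bar> / real (Suc \<mu>)) - 1" for \<mu>
  proof -
    let ?a = "\<lambda>l. fact \<mu> * ((- t) ^ l / (fact l * fact (\<mu> + l)))"
    let ?x = "\<bar>t\<bar> / real (Suc \<mu>)"
    have s: "?a sums (fact \<mu> * bessel_clifford \<mu> t)"
      unfolding bessel_clifford_def by (intro sums_mult summable_sums summable_bessel_clifford)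
    then have s': "(\<lambda>l. ?a (Suc l)) sums (fact \<mu> * bessel_clifford \<mu> t - 1)"
      by (subst sums_Suc_iff) simp
    have e: "(\<lambda>l. ?x ^ l /\<^sub>R fact l) sums exp ?x"
      by (rule exp_converges)
    have e': "(\<lambda>l. ?x ^ Suc l /\<^sub>R fact (Suc l)) sums (exp ?x - 1)"
      using e by (subst sums_Suc_iff) simp
    have le: "fact \<mu> * real (Suc \<mu>) ^ l \<le> fact (\<mu> + l)" for l
    proof (induction l)
      case (Suc l)
      have "fact \<mu> * real (Suc \<mu>) ^ Suc l = real (Suc \<mu>) * (fact \<mu> * real (Suc \<mu>) ^ l)"
        by simp
      also have "\<dots> \<le> real (Suc (\<mu> + l)) * fact (\<mu> + l)"
        using Suc by (intro mult_mono) auto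
      finally show ?case by simp
    qed simp
    have "norm (?a l) \<le> ?x ^ l /\<^sub>R fact l" for l
    proof -
      have "norm (?a l) = \<bar>t\<bar> ^ l / fact l * (fact \<mu> / fact (\<mu> + l))"
        by (simp add: abs_mult power_abs)
      also have "\<dots> \<le> \<bar>t\<bar> ^ l / fact l * (1 / real (Suc \<mu>) ^ l)"
        using le[of l] by (intro mult_left_mono) (simp_all add: field_simps del: of_nat_Suc)
      finally show ?thesis
        by (simp add: power_divide divide_inverse power_mult_distrib power_inverse mult_ac del: of_nat_Suc)
    qed
    from norm_suminf_le[OF this sums_summable[OF e']]
    have "norm (\<Sum>l. ?a (Suc l)) \<le> (\<Sum>l. ?x ^ Suc l /\<^sub>R fact (Suc l))" .
    with s' e' show ?thesis by (simp add: sums_iff)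
  qed
  have "(\<lambda>\<mu>. fact \<mu> * bessel_clifford \<mu> t - 1) \<longlonglongrightarrow> 0"
  proof (rule Lim_null_comparison)
    show "(\<lambda>\<mu>. exp (\<bar>t\<bar> / real (Suc \<mu>)) - 1) \<longlonglongrightarrow> 0"
      by real_asymp
  qed (use bound in auto)
  then show ?thesis
    by (simp add: LIM_zero_iff)
qed

text \<open>The ratio tends to 1 as the order grows, and the three-term recurrence carries the bound down to the
  order \<open>\<nu>\<close> because \<open>1 / (1 - (6/5) / 8) \<le> 6/5\<close>.\<close>

lemma bessel_clifford_ratio:
  fixes t :: real
  assumes "0 \<le> t" "t \<le> (real \<nu>)\<^sup>2 / 8"
  shows "bessel_clifford \<nu> t > 0 \<and> real (Suc \<nu>) * bessel_clifford (Suc \<nu>) t \<le> 6/5 * bessel_clifford \<nu> t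
    \<and> bessel_clifford (Suc \<nu>) t > 0"
proof -
  define P where "P = (\<lambda>\<mu>. bessel_clifford \<mu> t > 0 \<and> real (Suc \<mu>) * bessel_clifford (Suc \<mu>) t \<le> 6/5 * bessel_clifford \<mu> t)"
  have "\<forall>\<^sub>F \<mu> in sequentially. fact \<mu> * bessel_clifford \<mu> t > 19/20"
       "\<forall>\<^sub>F \<mu> in sequentially. fact \<mu> * bessel_clifford \<mu> t < 21/20"
    by (rule order_tendstoD[OF fact_mult_bessel_clifford_tendsto]; simp)+
  then have "\<forall>\<^sub>F \<mu> in sequentially. fact \<mu> * bessel_clifford \<mu> t > 19/20 \<and> fact \<mu> * bessel_clifford \<mu> t < 21/20"
    by (rule eventually_conj)
  \<comment> \<open>As 21/20 <= 6/5 * 19/20, these two bounds yield the ratio 6/5 at every large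
    order.\<close>
  then obtain M where M: "\<And>\<mu>. \<mu> \<ge> M \<Longrightarrow> fact \<mu> * bessel_clifford \<mu> t > 19/20 \<and> fact \<mu> * bessel_clifford \<mu> t < 21/20"
    unfolding eventually_sequentially by blast
  have large: "P \<mu>" if "\<mu> \<ge> M" for \<mu>
  proof -
    have a: "fact \<mu> * bessel_clifford \<mu> t > 19/20"
      and b: "fact (Suc \<mu>) * bessel_clifford (Suc \<mu>) t < 21/20"
      using M[of \<mu>] M[of "Suc \<mu>"] that by auto
    have pos: "bessel_clifford \<mu> t > 0"
      by (rule zero_less_mult_pos[of "fact \<mu>"]) (use a in auto)
    have "fact \<mu> * (real (Suc \<mu>) * bessel_clifford (Suc \<mu>) t) \<le> 6/5 * (fact \<mu> * bessel_clifford \<mu> t)"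
      using a b by (simp add: algebra_simps)
    then have "fact \<mu> * (real (Suc \<mu>) * bessel_clifford (Suc \<mu>) t) \<le> fact \<mu> * (6/5 * bessel_clifford \<mu> t)"
      by (simp only: mult_ac)
    then show ?thesis
      unfolding P_def using pos by (subst (asm) mult_le_cancel_left_pos) auto
  qed
  have down: "P \<mu>" if P: "P (Suc \<mu>)" and le: "\<nu> \<le> \<mu>" for \<mu>
  proof -
    let ?g = "bessel_clifford (Suc \<mu>) t"
    from P have g: "?g > 0" and r: "real (Suc (Suc \<mu>)) * bessel_clifford (Suc (Suc \<mu>)) t \<le> 6/5 * ?g"
      by (auto simp: P_def)
    have "t \<le> (real \<nu>)\<^sup>2 / 8" by fact
    also have "\<dots> \<le> real (Suc \<mu>) * real (Suc (Suc \<mu>)) / 8"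
      unfolding power2_eq_square using le by (intro divide_right_mono mult_mono) auto
    finally have t: "t \<le> real (Suc \<mu>) * real (Suc (Suc \<mu>)) / 8" .
    have "t * (real (Suc (Suc \<mu>)) * bessel_clifford (Suc (Suc \<mu>)) t) \<le> t * (6/5 * ?g)"
      using r assms by (intro mult_left_mono) auto
    also have "\<dots> \<le> real (Suc \<mu>) * real (Suc (Suc \<mu>)) / 8 * (6/5 * ?g)"
      using t g by (intro mult_right_mono) auto
    finally have "real (Suc (Suc \<mu>)) * (t * bessel_clifford (Suc (Suc \<mu>)) t) \<le> real (Suc (Suc \<mu>)) * (3/20 * real (Suc \<mu>) * ?g)"
      by (simp add: field_simps)
    then have "t * bessel_clifford (Suc (Suc \<mu>)) t \<le> 3/20 * real (Suc \<mu>) * ?g"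
      by (subst (asm) mult_le_cancel_left_pos) auto
    \<comment> \<open>17/20 = 1 - 3/20 with 3/20 = (6/5) / 8. Since 6/5 * 17/20 >= 1, the ratio
      bound reproduces itself one order lower.\<close>
    then have low: "bessel_clifford \<mu> t \<ge> 17/20 * real (Suc \<mu>) * ?g"
      using bessel_clifford_rec[of \<mu> t] by linarith
    moreover have pos: "17/20 * real (Suc \<mu>) * ?g > 0" using g by simp
    ultimately show ?thesis
      unfolding P_def by (intro conjI) linarith+
  qed
  have all: "P \<mu>" if "\<nu> \<le> \<mu>" for \<mu>
  proof (cases "\<mu> \<ge> M")
    case True then show ?thesis by (rule large)
  next
    case False
    then have "\<mu> \<le> M" by simp
    from this that show ?thesis
    proof (induction rule: inc_induct)
      case base
      show ?case by (rule large) simp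
    next
      case (step i)
      show ?case by (rule down[OF step.IH]) (use step.prems in auto)
    qed
  qed
  show ?thesis using all[of \<nu>] all[of "Suc \<nu>"] by (auto simp: P_def)
qed

text \<open>On all of [0, t] the logarithmic derivative lies between -6 / (5 (\<nu> + 1)) and 0, by
  the ratio bound; integrate it from 0, where the value is 1 / \<nu>!. With t <= \<nu>^2 / 8 the
  total loss in the exponent is at most 3/20 * \<nu>.\<close>

lemma bessel_clifford_bounds:
  fixes t :: real
  assumes "0 \<le> t" "t \<le> (real \<nu>)\<^sup>2 / 8"
  shows "bessel_clifford \<nu> t \<le> 1 / fact \<nu>"
    and "exp (- 3/20 * real \<nu>) / fact \<nu> \<le> bessel_clifford \<nu> t"
proof -
  have ratio: "bessel_clifford \<nu> s > 0" "real (Suc \<nu>) * bessel_clifford (Suc \<nu>) s \<le> 6/5 * bessel_clifford \<nu> s"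
      "bessel_clifford (Suc \<nu>) s > 0"
    if "0 \<le> s" "s \<le> t" for s
    using bessel_clifford_ratio[of s \<nu>] that assms by auto
  have "bessel_clifford \<nu> t \<le> bessel_clifford \<nu> 0"
  proof (rule DERIV_nonpos_imp_nonincreasing[OF assms(1)])
    fix s assume "0 \<le> s" "s \<le> t"
    then show "\<exists>y. (bessel_clifford \<nu> has_real_derivative y) (at s) \<and> y \<le> 0"
      by (intro exI[of _ "- bessel_clifford (Suc \<nu>) s"] conjI has_real_derivative_bessel_clifford)
        (use ratio(3)[of s] in auto)
  qed
  then show "bessel_clifford \<nu> t \<le> 1 / fact \<nu>" by simp
  define b where "b = 6/5 / real (Suc \<nu>)"
  let ?h = "\<lambda>s. bessel_clifford \<nu> s * exp (b * s)"
  have "?h 0 \<le> ?h t"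
  proof (rule DERIV_nonneg_imp_nondecreasing[OF assms(1)])
    fix s assume s: "0 \<le> s" "s \<le> t"
    have "(?h has_real_derivative (- bessel_clifford (Suc \<nu>) s + b * bessel_clifford \<nu> s) * exp (b * s)) (at s)"
      by (auto intro!: derivative_eq_intros has_real_derivative_bessel_clifford simp: algebra_simps)
    moreover have "- bessel_clifford (Suc \<nu>) s + b * bessel_clifford \<nu> s \<ge> 0"
      using ratio(2)[OF s] by (simp add: b_def field_simps)
    ultimately show "\<exists>y. (?h has_real_derivative y) (at s) \<and> 0 \<le> y"
      by (metis exp_ge_zero mult_nonneg_nonneg)
  qed
  then have "1 / fact \<nu> \<le> bessel_clifford \<nu> t * exp (b * t)"
    by simp
  also have "b * t \<le> 3/20 * real \<nu>"
  proof -
    have "b * t \<le> b * ((real \<nu>)\<^sup>2 / 8)" using assms by (intro mult_left_mono) (auto simp: b_def)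
    also have "\<dots> = 3/20 * (real \<nu> * (real \<nu> / real (Suc \<nu>)))" by (simp add: b_def power2_eq_square field_simps)
    also have "\<dots> \<le> 3/20 * (real \<nu> * 1)" by (intro mult_left_mono) auto
    finally show ?thesis by simp
  qed
  then have "bessel_clifford \<nu> t * exp (b * t) \<le> bessel_clifford \<nu> t * exp (3/20 * real \<nu>)"
    by (intro mult_left_mono) (use ratio(1)[of t] assms in auto)
  finally show "exp (- 3/20 * real \<nu>) / fact \<nu> \<le> bessel_clifford \<nu> t"
    by (simp add: exp_minus field_simps)
qed

subsection \<open>An integral along a horizontal line\<close>

text \<open>Only exp (a / z) is expanded, uniformly on the unit circle. Each resulting term has a
  pole, and Cauchy's formula for the higher derivatives of exp (b z) at 0 evaluates it.\<close>

lemma residue_exp_essential: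
  fixes a b :: complex
  shows "residue (\<lambda>z. exp (a / z + b * z) / z ^ Suc \<nu>) 0 = b ^ \<nu> * bessel_clifford \<nu> (- (a * b))"
proof -
  let ?f = "\<lambda>z. exp (a / z + b * z) / z ^ Suc \<nu>"
  define g where "g = (\<lambda>l z. a ^ l / fact l * (exp (b * z) / z ^ Suc (\<nu> + l)))"
  define w where "w = (\<lambda>l. 2 * pi * \<i> * (b ^ \<nu> * ((a * b) ^ l / (fact l * fact (\<nu> + l)))))"
  have "?f holomorphic_on UNIV - {0}"
    by (intro holomorphic_intros) auto
  then have res: "(?f has_contour_integral 2 * pi * \<i> * residue ?f 0) (circlepath 0 1)"
    by (intro base_residue[of UNIV]) auto
  have deriv: "(deriv ^^ n) (\<lambda>z. exp (b * z)) z = b ^ n * exp (b * z)" for n z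
  proof (induction n arbitrary: z)
    case (Suc n)
    have "(deriv ^^ n) (\<lambda>z. exp (b * z)) = (\<lambda>z. b ^ n * exp (b * z))"
      using Suc by auto
    moreover have "deriv (\<lambda>z. b ^ n * exp (b * z)) z = b ^ Suc n * exp (b * z)"
      by (rule DERIV_imp_deriv) (auto intro!: derivative_eq_intros)
    ultimately show ?case by simp
  qed simp
  have g: "(g l has_contour_integral w l) (circlepath 0 1)" for l
  proof -
    have "((\<lambda>u. exp (b * u) / (u - 0) ^ Suc (\<nu> + l)) has_contour_integral
        (2 * pi * \<i> / fact (\<nu> + l) * (deriv ^^ (\<nu> + l)) (\<lambda>z. exp (b * z)) 0)) (circlepath 0 1)"
      by (intro Cauchy_has_contour_integral_higher_derivative_circlepath)
         (auto intro!: continuous_intros holomorphic_intros)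
    from has_contour_integral_lmul[OF this[unfolded deriv], of "a ^ l / fact l"] show ?thesis
      by (simp add: g_def w_def power_add power_mult_distrib mult_ac)
  qed
  have lim: "uniform_limit (sphere 0 1) (\<lambda>n z. \<Sum>l<n. g l z) (\<lambda>z. \<Sum>l. g l z) sequentially"
  proof (rule Weierstrass_m_test)
    show "summable (\<lambda>l. norm a ^ l /\<^sub>R fact l * exp (norm b))"
      by (intro summable_mult2 summable_exp_generic)
    fix l z assume "z \<in> sphere (0::complex) 1"
    then have "norm z = 1" by simp
    then have "norm (g l z) = norm a ^ l / fact l * norm (exp (b * z))"
      by (simp add: g_def norm_mult norm_divide norm_power)
    also have "\<dots> \<le> norm a ^ l / fact l * exp (norm b)"
      using norm_exp[of "b * z"] \<open>norm z = 1\<close> by (intro mult_left_mono) (auto simp: norm_mult)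
    finally show "norm (g l z) \<le> norm a ^ l /\<^sub>R fact l * exp (norm b)"
      by (simp add: divide_inverse mult_ac)
  qed
  have sum_g: "(\<Sum>l. g l z) = ?f z" if "z \<in> sphere 0 1" for z
  proof -
    have "(\<lambda>l. (a / z) ^ l /\<^sub>R fact l) sums exp (a / z)"
      by (rule exp_converges)
    from sums_mult2[OF this, of "exp (b * z) / z ^ Suc \<nu>"]
    have "g sums ?f z" if "g = (\<lambda>l. (a / z) ^ l /\<^sub>R fact l * (exp (b * z) / z ^ Suc \<nu>))" for g
      using that by (simp add: exp_add)
    moreover have "(\<lambda>l. g l z) = (\<lambda>l. (a / z) ^ l /\<^sub>R fact l * (exp (b * z) / z ^ Suc \<nu>))"
      by (simp add: fun_eq_iff g_def power_divide power_add scaleR_conv_of_real divide_inverse power_mult_distrib power_inverse mult_ac)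
    ultimately show ?thesis by (auto simp: sums_iff)
  qed
  have partial: "((\<lambda>z. \<Sum>l<n. g l z) has_contour_integral (\<Sum>l<n. w l)) (circlepath 0 1)" for n
    by (rule has_contour_integral_sum) (use g in auto)
  have "uniform_limit (sphere 0 1) (\<lambda>n z. \<Sum>l<n. g l z) ?f sequentially"
    using lim by (rule uniform_limit_cong'[THEN iffD1, rotated -1]) (use sum_g in auto)
  then have "(\<lambda>n. contour_integral (circlepath 0 1) (\<lambda>z. \<Sum>l<n. g l z)) \<longlonglongrightarrow>
      contour_integral (circlepath 0 1) ?f"
    by (intro contour_integral_uniform_limit_circlepath(2))
       (auto intro!: always_eventually has_contour_integral_integrable[OF partial])
  moreover have "contour_integral (circlepath 0 1) (\<lambda>z. \<Sum>l<n. g l z) = (\<Sum>l<n. w l)" for n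
    by (rule contour_integral_unique) (rule partial)
  ultimately have "w sums (2 * pi * \<i> * residue ?f 0)"
    using contour_integral_unique[OF res] by (simp add: sums_def)
  moreover have "w sums (2 * pi * \<i> * (b ^ \<nu> * bessel_clifford \<nu> (- (a * b))))"
    unfolding w_def bessel_clifford_def
    by (intro sums_mult) (use summable_sums[OF summable_bessel_clifford[of "- (a * b)" \<nu>]] in simp)
  ultimately have "2 * pi * \<i> * residue ?f 0 = 2 * pi * \<i> * (b ^ \<nu> * bessel_clifford \<nu> (- (a * b)))"
    by (rule sums_unique2)
  then show ?thesis by simp
qed

text \<open>The integrand decays in the lower half plane, so the line is closed up by a large rectangle around
  the essential singularity at 0.\<close>

lemma horizontal_line_integral_exp:
  fixes \<alpha> \<beta> s :: real
  assumes "\<alpha> \<ge> 0" "\<beta> \<ge> 0" "\<nu> \<ge> 1"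
  defines "f \<equiv> \<lambda>z. exp (- \<i> * \<alpha> / z + - \<i> * \<beta> * z) / z ^ Suc \<nu>"
  shows "(\<lambda>T::nat. integral {- real T..real T} (\<lambda>x. f (of_real x + of_real s + \<i>)))
    \<longlonglongrightarrow> - (2 * pi * \<i> * ((- \<i> * \<beta>) ^ \<nu> * of_real (bessel_clifford \<nu> (\<alpha> * \<beta>))))"
proof -
  define L where "L = 2 * pi * \<i> * ((- \<i> * \<beta>) ^ \<nu> * of_real (bessel_clifford \<nu> (\<alpha> * \<beta>)))"
  define I where "I = (\<lambda>T::nat. integral {- real T..real T} (\<lambda>x. f (of_real x + of_real s + \<i>)))"
  have holo: "f holomorphic_on UNIV - {0}"
    unfolding f_def by (intro holomorphic_intros) auto
  have cont: "continuous_on (UNIV - {0}) f"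
    by (rule holomorphic_on_imp_continuous_on) fact
  have "- ((- \<i> * \<alpha>) * (- \<i> * \<beta>)) = of_real (\<alpha> * \<beta>)"
    by (simp add: complex_eq_iff)
  then have res: "residue f 0 = (- \<i> * \<beta>) ^ \<nu> * of_real (bessel_clifford \<nu> (\<alpha> * \<beta>))"
    using residue_exp_essential[of "- \<i> * \<alpha>" "- \<i> * \<beta>" \<nu>]
    unfolding f_def bessel_clifford_of_real[symmetric] by simp
  have bound: "norm (I T + L) \<le> exp (\<alpha> + \<beta>) * (4 * T + 2) / (T - \<bar>s\<bar>)\<^sup>2" if T: "real T \<ge> \<bar>s\<bar> + 1" for T
  proof -
    define r where "r = real T - \<bar>s\<bar>"
    have r: "r \<ge> 1" using T by (simp add: r_def)
    have "T > 0" using T by (cases T) auto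
    define B where "B = exp (\<alpha> + \<beta>) / r\<^sup>2"
    have B: "B \<ge> 0" by (simp add: B_def)
    \<comment> \<open>Corners in counterclockwise order from the lower left. The top edge is the
      segment of integration; the other three edges stay at distance at least T - |s| from the
      singularity.\<close>
    define a1 a2 a3 a4 where "a1 = Complex (s - T) (- T)" and "a2 = Complex (s + T) (- T)"
      and "a3 = Complex (s + T) 1" and "a4 = Complex (s - T) 1"
    \<comment> \<open>Below height 1 the exponential is bounded by exp (\<alpha> + \<beta>), and
      \<nu> >= 1 leaves decay of order r^(-2), which beats the length 4 T + 2 of the three
      edges.\<close>
    have fB: "norm (f z) \<le> B" if z: "r \<le> norm z" "Im z \<le> 1" for z
    proof -
      have "Re (- \<i> * \<alpha> / z + - \<i> * \<beta> * z) = Re (- \<i> * \<alpha> / z) + \<beta> * Im z"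
        by simp
      also have "Re (- \<i> * \<alpha> / z) \<le> norm (- \<i> * \<alpha> / z)" by (rule complex_Re_le_cmod)
      also have "\<dots> = \<alpha> / norm z" using assms by (simp add: norm_divide norm_mult)
      also have "\<dots> \<le> \<alpha> / 1" using z r assms by (intro divide_left_mono) auto
      also have "\<beta> * Im z \<le> \<beta> * 1" using z assms by (intro mult_left_mono) auto
      finally have "norm (exp (- \<i> * \<alpha> / z + - \<i> * \<beta> * z)) \<le> exp (\<alpha> + \<beta>)"
        by (simp only: norm_exp_eq_Re exp_le_cancel_iff)  simp
      moreover have "r ^ 2 \<le> norm z ^ Suc \<nu>"
      proof -
        have "r ^ 2 \<le> r ^ Suc \<nu>" using r assms by (intro power_increasing) auto
        also have "\<dots> \<le> norm z ^ Suc \<nu>" using z r by (intro power_mono) auto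
        finally show ?thesis .
      qed
      ultimately show ?thesis
        unfolding f_def B_def norm_divide norm_power using r by (intro frac_le) auto
    qed
    have seg: "r \<le> norm z \<and> Im z \<le> 1"
      if "z \<in> closed_segment a1 a2 \<union> closed_segment a2 a3 \<union> closed_segment a4 a1" for z
    proof -
      have "Im z \<le> 1 \<and> (\<bar>Re z\<bar> \<ge> r \<or> \<bar>Im z\<bar> \<ge> r)"
        using that T unfolding a1_def a2_def a3_def a4_def r_def
        by (auto simp: closed_segment_same_Re closed_segment_same_Im closed_segment_eq_real_ivl split: if_splits)
      then show ?thesis using abs_Re_le_cmod[of z] abs_Im_le_cmod[of z] by linarith
    qed
    have top: "z \<noteq> 0" if "z \<in> closed_segment a3 a4" for z
      using that by (auto simp: a3_def a4_def closed_segment_same_Im)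
    have nz: "z \<noteq> 0" if "z \<in> closed_segment a1 a2 \<union> closed_segment a2 a3 \<union> closed_segment a4 a1" for z
      using seg[OF that] r by auto
    have int: "f contour_integrable_on linepath p q" if "\<And>z. z \<in> closed_segment p q \<Longrightarrow> z \<noteq> 0" for p q
      by (intro contour_integrable_continuous_linepath continuous_on_subset[OF cont]) (use that in auto)
    note ints = int[of a1 a2] int[of a2 a3] int[of a3 a4] int[of a4 a1]
    have rect: "rectpath a1 a3 = linepath a1 a2 +++ linepath a2 a3 +++ linepath a3 a4 +++ linepath a4 a1"
      by (simp add: rectpath_def a1_def a2_def a3_def a4_def Let_def)
    have "contour_integral (rectpath a1 a3) f =
        2 * pi * \<i> * (\<Sum>p\<in>{0}. winding_number (rectpath a1 a3) p * residue f p)"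
    proof (rule Residue_theorem[of UNIV])
      have "path_image (rectpath a1 a3) = closed_segment a1 a2 \<union> closed_segment a2 a3 \<union>
          closed_segment a3 a4 \<union> closed_segment a4 a1"
        by (simp add: rect path_image_join Un_assoc)
      then show "path_image (rectpath a1 a3) \<subseteq> UNIV - {0}"
        using nz top by auto
    qed (use holo in auto)
    moreover have "winding_number (rectpath a1 a3) 0 = 1"
      by (intro winding_number_rectpath) (use T \<open>T > 0\<close> in \<open>auto simp: a1_def a3_def in_box_complex_iff\<close>)
    ultimately have 1: "contour_integral (rectpath a1 a3) f = L"
      by (simp add: res L_def)
    have 2: "contour_integral (rectpath a1 a3) f = contour_integral (linepath a1 a2) f +
       contour_integral (linepath a2 a3) f + contour_integral (linepath a3 a4) f + contour_integral (linepath a4 a1) f"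
      unfolding rect using ints nz top by (simp add: contour_integrable_joinI valid_path_join)
    \<comment> \<open>The positively oriented rectangle runs along its top edge from right to left,
      which is where the minus sign of the limit comes from.\<close>
    have "contour_integral (linepath a3 a4) f = - contour_integral (linepath a4 a3) f"
      using int[of a4 a3] top
      by (intro contour_integral_reverse_linepath continuous_on_subset[OF cont]) (auto simp: closed_segment_commute)
    also have "contour_integral (linepath a4 a3) f =
        contour_integral (linepath (of_real (- real T)) (of_real (real T))) (\<lambda>z. f (z + of_real s + \<i>))"
    proof -
      have *: "linepath a4 a3 x = linepath (of_real (- real T)) (of_real (real T)) x + of_real s + \<i>" for x
        by (simp add: a3_def a4_def linepath_def complex_eq_iff algebra_simps)
      have **: "a3 - a4 = of_real (real T) - of_real (- real T)"
        by (simp add: a3_def a4_def complex_eq_iff)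
      show ?thesis
        unfolding contour_integral_integral vector_derivative_linepath_at * ** ..
    qed
    also have "\<dots> = I T"
      unfolding I_def by (subst contour_integral_linepath_Reals_eq) (use \<open>T > 0\<close> in auto)
    finally have top_eq: "contour_integral (linepath a3 a4) f = - I T" .
    have "I T + L = contour_integral (linepath a1 a2) f +
       contour_integral (linepath a2 a3) f + contour_integral (linepath a4 a1) f"
      using 1[symmetric] 2 top_eq by simp
    also have "norm \<dots> \<le> B * norm (a2 - a1) + B * norm (a3 - a2) + B * norm (a1 - a4)"
      by (intro norm_triangle_mono contour_integral_bound_linepath int B fB) (use seg nz in auto)
    also have "\<dots> = B * (4 * T + 2)"
    proof -
      have "a2 - a1 = of_real (2 * T)" "a3 - a2 = \<i> * of_real (T + 1)" "a1 - a4 = - \<i> * of_real (T + 1)"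
        by (simp_all add: a1_def a2_def a3_def a4_def complex_eq_iff)
      then show ?thesis
        by (simp only: norm_mult norm_of_real norm_minus_cancel norm_ii) (simp add: algebra_simps)
    qed
    finally show ?thesis by (simp add: B_def r_def add.commute)
  qed
  have "(\<lambda>T. I T + L) \<longlonglongrightarrow> 0"
  proof (rule Lim_null_comparison)
    show "\<forall>\<^sub>F T in sequentially. norm (I T + L) \<le> exp (\<alpha> + \<beta>) * (4 * real T + 2) / (T - \<bar>s\<bar>)\<^sup>2"
      using eventually_ge_at_top[of "nat \<lceil>\<bar>s\<bar> + 1\<rceil>"] by eventually_elim (rule bound, linarith)
    show "(\<lambda>T::nat. exp (\<alpha> + \<beta>) * (4 * real T + 2) / (T - \<bar>s\<bar>)\<^sup>2) \<longlonglongrightarrow> 0"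
      by real_asymp
  qed
  then have "(\<lambda>T. I T + L - L) \<longlonglongrightarrow> 0 - L" by (intro tendsto_diff) auto
  then show ?thesis by (simp add: I_def L_def)
qed

subsection \<open>Kloosterman sums of level N\<close>

lemma e_add: "e (x + y) = e x * e y"
  by (simp add: e_def distrib_left exp_add)

lemma e_of_int [simp]: "e (of_int n) = 1"
proof -
  have "e (of_int n) = exp (2 * of_int n * of_real pi * \<i>)"
    by (simp add: e_def mult_ac)
  also have "\<dots> = 1" by (simp add: exp_eq_1)
  finally show ?thesis .
qed

lemma norm_e: "norm (e z) = exp (- 2 * pi * Im z)"
  by (simp add: e_def)

definition add_char :: "int \<Rightarrow> int \<Rightarrow> complex" where
  "add_char c a = e (of_int a / of_int c)"

lemma norm_add_char [simp]: "norm (add_char c a) = 1"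
proof -
  have "of_int a / of_int c = complex_of_real (of_int a / of_int c)" by simp
  then have "Im (of_int a / of_int c) = 0" by (simp only: Im_complex_of_real)
  then show ?thesis by (simp add: add_char_def norm_e)
qed

lemma add_char_add: "add_char c (a + b) = add_char c a * add_char c b"
  by (simp add: add_char_def e_add[symmetric] add_divide_distrib)

lemma add_char_eq_1: "c \<noteq> 0 \<Longrightarrow> c dvd a \<Longrightarrow> add_char c a = 1"
  by (auto simp: add_char_def elim!: dvdE)

lemma add_char_cong:
  assumes "[a = b] (mod c)"
  shows "add_char c a = add_char c b"
proof (cases "c = 0")
  case False
  have "add_char c a = add_char c b * add_char c (a - b)"
    by (simp add: add_char_add[symmetric])
  also have "add_char c (a - b) = 1"
    using False assms by (intro add_char_eq_1) (auto simp: cong_iff_dvd_diff)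
  finally show ?thesis by simp
qed (use assms in \<open>auto simp: cong_def\<close>)

lemma add_char_mult_cancel: "N \<noteq> 0 \<Longrightarrow> add_char (j * N) (a * N) = add_char j a"
  by (simp add: add_char_def)

lemma add_char_eq_1_iff:
  assumes "c \<noteq> 0"
  shows "add_char c a = 1 \<longleftrightarrow> c dvd a"
proof
  assume "add_char c a = 1"
  then obtain n where n: "Im (2 * of_real pi * \<i> * (of_int a / of_int c)) = of_int (2 * n) * pi"
    unfolding add_char_def e_def exp_eq_1 by blast
  have "2 * of_real pi * \<i> * (of_int a / of_int c :: complex) = \<i> * of_real (2 * pi * (of_int a / of_int c))"
    by simp
  then have "2 * pi * (of_int a / of_int c) = of_int (2 * n) * pi"
    using n by (simp only: Im_i_times Re_complex_of_real)
  then have "of_int a = of_int n * (of_int c :: real)"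
    using assms by (simp add: field_simps)
  then have "a = n * c" by (simp only: of_int_mult[symmetric] of_int_eq_iff)
  then show "c dvd a" by simp
qed (use assms add_char_eq_1 in auto)

lemma sum_shift_periodic:
  fixes g :: "int \<Rightarrow> 'a::comm_monoid_add"
  assumes "n > 0" and per: "\<And>s t. [s = t] (mod n) \<Longrightarrow> g s = g t"
  shows "(\<Sum>s\<in>{0..<n}. g (s + d)) = (\<Sum>s\<in>{0..<n}. g s)"
proof (rule sum.reindex_bij_witness[of _ "\<lambda>s. (s - d) mod n" "\<lambda>s. (s + d) mod n"])
  fix s assume s: "s \<in> {0..<n}"
  show "((s + d) mod n - d) mod n = s" "((s - d) mod n + d) mod n = s"
    using s by (simp_all add: mod_simps)
  show "g ((s + d) mod n) = g (s + d)" by (rule per) simp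
qed (use assms in auto)

section \<open>Character sums over residues coprime to a squarefree level\<close>

lemma prod_squarefree_prime_factors:
  fixes N :: nat
  assumes "squarefree N"
  shows "\<Prod>(prime_factors N) = N"
proof -
  have "N \<noteq> 0" using assms by (intro notI) simp
  then have "N = (\<Prod>p\<in>prime_factors N. p ^ multiplicity p N)"
    by (simp add: prod_prime_factors)
  also have "\<dots> = \<Prod>(prime_factors N)"
  proof (rule prod.cong)
    fix p assume "p \<in> prime_factors N"
    then have "multiplicity p N = 1"
      using assms squarefree_factorial_semiring'[of N] \<open>N \<noteq> 0\<close> by auto
    then show "p ^ multiplicity p N = p" by simp
  qed simp
  finally show ?thesis by simp
qed

text \<open>Expand the product over the primes p of N of (1 - [p divides x]). The subsets D stand
  for the squarefree divisors of N, and (-1)^card D is the Moebius value.\<close>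

lemma coprime_indicator_eq_sum:
  fixes N :: nat and x :: int
  assumes "N > 0"
  shows "(if coprime x (int N) then 1 else 0 :: complex) =
    (\<Sum>D\<in>Pow (prime_factors N). (- 1) ^ card D * (if int (\<Prod>D) dvd x then 1 else 0))"
proof -
  let ?P = "prime_factors N"
  let ?b = "\<lambda>p. if int p dvd x then - 1 else 0 :: complex"
  have "(\<Prod>p\<in>?P. ?b p + 1) = (if coprime x (int N) then 1 else 0)"
  proof (cases "coprime x (int N)")
    case True
    have "\<not> int p dvd x" if "p \<in> ?P" for p
    proof
      assume "int p dvd x"
      moreover from that have "int p dvd int N" by auto
      ultimately have "int p dvd 1" using True coprime_common_divisor by blast
      then show False using that by (auto dest: in_prime_factors_imp_prime)
    qed
    then show ?thesis using True by simp
  next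
    case False
    then have "gcd x (int N) \<noteq> 0" "\<not> is_unit (gcd x (int N))"
      using \<open>N > 0\<close> by (auto simp: coprime_iff_gcd_eq_1)
    then obtain p :: int where "p dvd gcd x (int N)" "prime p"
      using prime_divisor_exists by blast
    then have p: "prime p" "p dvd x" "p dvd int N" by auto
    obtain q where q: "p = int q"
      using prime_ge_0_int[OF p(1)] nonneg_int_cases by blast
    with p have "q \<in> ?P" "int q dvd x"
      using \<open>N > 0\<close> by (auto simp: in_prime_factors_iff)
    then have "(\<Prod>p\<in>?P. ?b p + 1) = 0"
      by (intro prod_zero) auto
    then show ?thesis using False by simp
  qed
  moreover have "(\<Prod>p\<in>?P. ?b p + 1) = (\<Sum>D\<in>Pow ?P. (\<Prod>p\<in>D. ?b p) * (\<Prod>p\<in>?P - D. 1))"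
    by (rule prod_add) simp
  moreover have "(\<Prod>p\<in>D. ?b p) = (- 1) ^ card D * (if int (\<Prod>D) dvd x then 1 else 0)" if "D \<subseteq> ?P" for D
  proof -
    have fin: "finite D" using that finite_subset by auto
    have "int (\<Prod>D) dvd x \<longleftrightarrow> (\<forall>p\<in>D. int p dvd x)"
    proof
      assume *: "int (\<Prod>D) dvd x"
      show "\<forall>p\<in>D. int p dvd x"
        using * dvd_prodI[OF fin, of _ "\<lambda>p. p"] by (metis dvd_trans int_dvd_int_iff)
    next
      assume *: "\<forall>p\<in>D. int p dvd x"
      from fin \<open>D \<subseteq> ?P\<close> * show "int (\<Prod>D) dvd x"
      proof (induction D rule: finite_induct)
        case (insert p D)
        have "coprime p (\<Prod>D)"
          using insert.hyps insert.prems
          by (intro prod_coprime_right) (auto intro!: primes_coprime dest: in_prime_factors_imp_prime)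
        then have "coprime (int p) (int (\<Prod>D))" by (simp only: coprime_int_iff)
        then have "int p * int (\<Prod>D) dvd x"
          using insert by (intro divides_mult) auto
        then show ?case using insert.hyps by simp
      qed simp
    qed
    then show ?thesis using fin by auto
  qed
  ultimately show ?thesis by simp
qed

lemma prod_proper_subset_prime_factors:
  fixes N :: nat
  assumes "squarefree N" "D \<subset> prime_factors N"
  shows "\<Prod>D > 0" "\<Prod>D < N" "\<Prod>D dvd N"
proof -
  let ?P = "prime_factors N"
  have prime: "prime p" if "p \<in> ?P" for p using that by auto
  have "N = \<Prod>?P" using assms prod_squarefree_prime_factors by simp
  also have "\<dots> = \<Prod>(?P - D) * \<Prod>D"
    using assms by (intro prod.subset_diff) auto
  finally have N: "N = \<Prod>(?P - D) * \<Prod>D" .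
  then show "\<Prod>D dvd N" by (metis dvd_triv_right)
  show pos: "\<Prod>D > 0"
    using assms prime by (intro prod_pos) (auto simp: prime_gt_0_nat)
  obtain p where p: "p \<in> ?P - D" using assms by auto
  have "finite (?P - D)" by simp
  then have "p dvd \<Prod>(?P - D)" using p by (rule dvd_prodI)
  moreover have "\<Prod>(?P - D) > 0"
    using prime by (intro prod_pos) (auto simp: prime_gt_0_nat)
  ultimately have "p \<le> \<Prod>(?P - D)" by (rule dvd_imp_le)
  then have "\<Prod>(?P - D) > 1" using prime[of p] p prime_gt_1_nat[of p] by auto
  then have "\<Prod>D < \<Prod>(?P - D) * \<Prod>D" using pos by simp
  then show "\<Prod>D < N" by (simp only: N[symmetric])
qed

text \<open>In the inclusion-exclusion over sets of primes with product \<open>d < N\<close>, the shift \<open>s \<mapsto> s + d\<close>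
  multiplies the inner sum by a nontrivial root of unity, so only \<open>d = N\<close> survives.\<close>

lemma sum_coprime_add_char:
  fixes N m :: nat and a j :: int
  assumes "squarefree N" "coprime m N"
  shows "(\<Sum>s\<in>{s\<in>{0..<int N}. coprime (a + j * s) (int N)}. add_char (int N) (int m * s)) =
    (- 1) ^ card (prime_factors N) *
    (\<Sum>s\<in>{s\<in>{0..<int N}. int N dvd a + j * s}. add_char (int N) (int m * s))"
proof -
  let ?P = "prime_factors N" and ?I = "{0..<int N}"
  let ?\<chi> = "\<lambda>s. add_char (int N) (int m * s)"
  define W where "W = (\<lambda>d. \<Sum>s\<in>?I. if int d dvd a + j * s then ?\<chi> s else 0)"
  have "N > 0" using assms by (auto intro: Nat.gr0I)
  have "(\<Sum>s\<in>{s\<in>?I. coprime (a + j * s) (int N)}. ?\<chi> s) =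
      (\<Sum>s\<in>?I. (if coprime (a + j * s) (int N) then 1 else 0) * ?\<chi> s)"
    by (subst sum.inter_filter) (auto intro!: sum.cong)
  also have "\<dots> = (\<Sum>s\<in>?I. \<Sum>D\<in>Pow ?P. (- 1) ^ card D * (if int (\<Prod>D) dvd a + j * s then ?\<chi> s else 0))"
    unfolding coprime_indicator_eq_sum[OF \<open>N > 0\<close>] sum_distrib_right
    by (intro sum.cong refl) simp
  also have "\<dots> = (\<Sum>D\<in>Pow ?P. (- 1) ^ card D * W (\<Prod>D))"
    by (subst sum.swap) (simp add: W_def sum_distrib_left)
  also have "\<dots> = (\<Sum>D\<in>{?P}. (- 1) ^ card D * W (\<Prod>D))"
  proof (rule sum.mono_neutral_right)
    show "\<forall>D\<in>Pow ?P - {?P}. (- 1) ^ card D * W (\<Prod>D) = 0"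
    proof
      fix D assume "D \<in> Pow ?P - {?P}"
      then have "D \<subset> ?P" by auto
      define d where "d = \<Prod>D"
      have d: "d > 0" "d < N" "d dvd N"
        using prod_proper_subset_prime_factors[OF assms(1) \<open>D \<subset> ?P\<close>] by (auto simp: d_def)
      let ?g = "\<lambda>s. if int d dvd a + j * s then ?\<chi> s else 0"
      have per: "?g s = ?g t" if "[s = t] (mod int N)" for s t
      proof -
        have "[a + j * s = a + j * t] (mod int d)"
          using that d(3) by (intro cong_add cong_mult cong_refl) (meson cong_dvd_modulus int_dvd_int_iff)
        then have "int d dvd a + j * s \<longleftrightarrow> int d dvd a + j * t"
          by (rule cong_dvd_iff)
        moreover have "?\<chi> s = ?\<chi> t"
          using that by (intro add_char_cong cong_mult cong_refl)
        ultimately show ?thesis by simp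
      qed
      have "?g (s + int d) = ?\<chi> (int d) * ?g s" for s
      proof -
        have "int d dvd a + j * (s + int d) \<longleftrightarrow> int d dvd a + j * s"
          by (metis add.assoc distrib_left dvd_add_left_iff dvd_triv_right)
        then show ?thesis by (simp add: distrib_left add_char_add)
      qed
      then have "?\<chi> (int d) * W d = (\<Sum>s\<in>?I. ?g (s + int d))"
        by (simp only: W_def sum_distrib_left)
      also have "\<dots> = W d"
        unfolding W_def by (rule sum_shift_periodic) (use \<open>N > 0\<close> per in auto)
      finally have "(?\<chi> (int d) - 1) * W d = 0" by (simp add: algebra_simps)
      \<comment> \<open>Coprimality of m and N reduces N dvd m * d to N dvd d, impossible for 0 < d
        < N; so the root of unity is nontrivial.\<close>
      moreover have "\<not> N dvd m * d"
        using d assms(2) by (metis coprime_commute coprime_dvd_mult_right_iff nat_dvd_not_less)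
      then have "?\<chi> (int d) \<noteq> 1"
        using \<open>N > 0\<close> by (subst add_char_eq_1_iff) (simp_all flip: of_nat_mult)
      ultimately show "(- 1) ^ card D * W (\<Prod>D) = 0" by (simp add: d_def)
    qed
  qed auto
  also have "\<dots> = (- 1) ^ card ?P * W N"
    using prod_squarefree_prime_factors[OF assms(1)] by simp
  also have "W N = (\<Sum>s\<in>{s\<in>?I. int N dvd a + j * s}. ?\<chi> s)"
    unfolding W_def by (subst sum.inter_filter) auto
  finally show ?thesis .
qed

text \<open>A common divisor of j and N that divides a + j s also divides a, hence is a unit. So
  either no s modulo N satisfies N dvd a + j s, or j is invertible modulo N and s is unique; at most
  one term survives.\<close>

lemma norm_sum_coprime_add_char_le:
  fixes N m :: nat and a j :: int
  assumes "squarefree N" "coprime m N" "coprime a j"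
  shows "norm (\<Sum>s\<in>{s\<in>{0..<int N}. coprime (a + j * s) (int N)}. add_char (int N) (int m * s)) \<le> 1"
proof -
  let ?S = "{s\<in>{0..<int N}. int N dvd a + j * s}"
  have uniq: "s = t" if st: "s \<in> ?S" "t \<in> ?S" for s t
  proof -
    have "coprime j (int N)"
    proof (rule coprimeI)
      fix q assume q: "q dvd j" "q dvd int N"
      then have "q dvd a + j * s" using st by (auto intro: dvd_trans)
      then have "q dvd a" using q by (simp add: dvd_add_left_iff)
      then show "is_unit q" using q assms(3) coprime_common_divisor by blast
    qed
    have "int N dvd (a + j * s) - (a + j * t)" using st by (intro dvd_diff) auto
    then have "int N dvd j * (s - t)" by (simp add: algebra_simps)
    then have "int N dvd s - t"
      using \<open>coprime j (int N)\<close> by (simp add: coprime_dvd_mult_right_iff coprime_commute)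
    then have "[s = t] (mod int N)" by (simp add: cong_iff_dvd_diff)
    then show ?thesis using st by (auto simp: cong_def)
  qed
  have "finite ?S" by (rule finite_subset[of _ "{0..<int N}"]) auto
  then have "card ?S \<le> Suc 0" by (subst card_le_Suc0_iff_eq) (use uniq in blast)+
  then have "card ?S \<le> 1" by simp
  have "norm (\<Sum>s\<in>?S. add_char (int N) (int m * s)) \<le> real (card ?S) * 1"
    by (rule sum_norm_bound) simp
  then show ?thesis
    using \<open>card ?S \<le> 1\<close> unfolding sum_coprime_add_char[OF assms(1,2)] norm_mult
    by (simp add: norm_power)
qed

definition kloosterman :: "int \<Rightarrow> int \<Rightarrow> int \<Rightarrow> complex" where
  "kloosterman m n c =
    (\<Sum>r\<in>{r\<in>{0..<c}. coprime r c}. add_char c (m * modular_inverse c r + n * r))"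

text \<open>Split the inverse \<open>r\<inverse>\<close> of the summation variable as \<open>a + j s\<close>; the phase of \<open>r\<close> only depends on \<open>a\<close>.\<close>

lemma kloosterman_level:
  fixes N m :: nat and h j :: int
  assumes "N > 0" "j > 0"
  shows "kloosterman m (h * N) (j * N) =
    (\<Sum>a\<in>{a\<in>{0..<j}. coprime a j}. add_char j (h * modular_inverse j a) * add_char (j * N) (int m * a) *
       (\<Sum>s\<in>{s\<in>{0..<int N}. coprime (a + j * s) (int N)}. add_char (int N) (int m * s)))"
proof -
  define c where "c = j * int N"
  have c: "c > 0" using assms by (simp add: c_def)
  let ?U = "{r\<in>{0..<c}. coprime r c}"
  let ?A = "{a\<in>{0..<j}. coprime a j}" and ?B = "\<lambda>a. {s\<in>{0..<int N}. coprime (a + j * s) (int N)}"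
  have inv: "modular_inverse c (modular_inverse c r) = r" if "r \<in> ?U" for r
    using that by (intro modular_inverse_int_eqI) (auto intro: cong_modular_inverse2)
  \<comment> \<open>Inversion permutes the units modulo c; after it the phase with h N sits on the
    inverse, where only the class modulo j is felt.\<close>
  have "kloosterman m (h * N) (j * N) = (\<Sum>r\<in>?U. add_char c (m * r + h * N * modular_inverse c r))"
    unfolding kloosterman_def c_def[symmetric]
    by (rule sum.reindex_bij_witness[of _ "modular_inverse c" "modular_inverse c"])
       (use c inv in \<open>auto simp: modular_inverse_int_nonneg modular_inverse_int_less\<close>)
  also have "\<dots> = (\<Sum>r\<in>?U. add_char c (m * r) * add_char j (h * modular_inverse c r))"
  proof (rule sum.cong)
    fix r
    have "add_char c (h * N * modular_inverse c r) = add_char (j * N) ((h * modular_inverse c r) * N)"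
      by (simp add: c_def mult_ac)
    also have "\<dots> = add_char j (h * modular_inverse c r)"
      using assms by (intro add_char_mult_cancel) auto
    finally show "add_char c (m * r + h * N * modular_inverse c r) =
        add_char c (m * r) * add_char j (h * modular_inverse c r)"
      by (simp add: add_char_add)
  qed simp
  also have "\<dots> = (\<Sum>(a, s)\<in>Sigma ?A ?B.
      add_char j (h * modular_inverse j a) * add_char c (m * a) * add_char (int N) (int m * s))"
  proof (rule sum.reindex_bij_witness[of _ "\<lambda>(a, s). a + j * s" "\<lambda>r. (r mod j, r div j)"])
    fix r assume r: "r \<in> ?U"
    have "r div j < int N"
    proof -
      have "j * (r div j) \<le> r"
        using assms mult_div_mod_eq[of j r] pos_mod_sign[of j r] by linarith
      also have "r < j * int N" using r by (simp add: c_def)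
      finally show ?thesis using assms by simp
    qed
    moreover have "coprime r j" "coprime r (int N)"
      using r by (auto simp: c_def)
    ultimately show "(r mod j, r div j) \<in> Sigma ?A ?B"
      using r assms by (auto simp: pos_imp_zdiv_nonneg_iff)
    \<comment> \<open>Since j divides c, an inverse of r modulo c is also one modulo j, and inverses
      modulo j are unique modulo j.\<close>
    have "[modular_inverse c r * r = 1] (mod j)"
      using cong_modular_inverse2[of r c] r by (auto simp: c_def intro: cong_modulus_mult)
    moreover have "[r mod j = r] (mod j)" by (simp add: cong_def)
    ultimately have "[modular_inverse j (r mod j) * (r * modular_inverse c r) = modular_inverse j (r mod j) * 1] (mod j)"
      by (intro cong_mult cong_refl) (simp add: mult.commute)
    moreover have "[(modular_inverse j (r mod j) * (r mod j)) * modular_inverse c r = 1 * modular_inverse c r] (mod j)"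
      using \<open>coprime r j\<close> assms by (intro cong_mult cong_refl cong_modular_inverse2) (simp add: coprime_mod_left_iff)
    moreover have "[modular_inverse j (r mod j) * (r * modular_inverse c r) =
        (modular_inverse j (r mod j) * (r mod j)) * modular_inverse c r] (mod j)"
      unfolding mult.assoc by (intro cong_mult cong_refl) (simp add: cong_def)
    ultimately have "[modular_inverse j (r mod j) = modular_inverse c r] (mod j)"
      by (simp add: cong_def)
    then have "add_char j (h * modular_inverse j (r mod j)) = add_char j (h * modular_inverse c r)"
      by (intro add_char_cong cong_mult cong_refl)
    moreover have "add_char c (m * r) = add_char c (m * (r mod j)) * add_char (int N) (m * (r div j))"
    proof -
      have "add_char c (m * r) = add_char c (m * (r mod j) + m * (j * (r div j)))"
        by (simp add: distrib_left[symmetric])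
      also have "\<dots> = add_char c (m * (r mod j)) * add_char (int N * j) ((m * (r div j)) * j)"
        by (simp add: add_char_add c_def mult_ac)
      also have "add_char (int N * j) ((m * (r div j)) * j) = add_char (int N) (m * (r div j))"
        using assms by (intro add_char_mult_cancel) auto
      finally show ?thesis .
    qed
    ultimately show "(case (r mod j, r div j) of (a, s) \<Rightarrow> add_char j (h * modular_inverse j a) *
        add_char c (m * a) * add_char (int N) (int m * s)) =
        add_char c (m * r) * add_char j (h * modular_inverse c r)"
      by simp
  next
    fix as assume "as \<in> Sigma ?A ?B"
    then obtain a s where as: "as = (a, s)" "a \<in> ?A" "s \<in> ?B a" by auto
    then show "((case as of (a, s) \<Rightarrow> a + j * s) mod j, (case as of (a, s) \<Rightarrow> a + j * s) div j) = as"
      using assms by auto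
    have "coprime (a + j * s) j"
      using as assms coprime_mod_left_iff[of j "a + j * s"] by auto
    moreover have "a + j * s < c"
    proof -
      have "a + j * s < j + j * s" using as by simp
      also have "\<dots> = j * (s + 1)" by (simp add: algebra_simps)
      also have "\<dots> \<le> j * int N" using as assms by (intro mult_left_mono) auto
      finally show ?thesis by (simp add: c_def)
    qed
    ultimately show "(case as of (a, s) \<Rightarrow> a + j * s) \<in> ?U"
      using as assms by (auto simp: c_def)
  qed auto
  also have "\<dots> = (\<Sum>a\<in>?A. add_char j (h * modular_inverse j a) * add_char c (m * a) *
       (\<Sum>s\<in>?B a. add_char (int N) (int m * s)))"
  proof -
    have "finite ?A" by (rule finite_subset[of _ "{0..<j}"]) auto
    moreover have "finite (?B a)" for a by (rule finite_subset[of _ "{0..<int N}"]) auto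
    ultimately show ?thesis by (subst sum.Sigma[symmetric]) (simp_all add: sum_distrib_left)
  qed
  finally show ?thesis by (simp only: c_def)
qed

text \<open>At most j classes a occur, each with unimodular phases times an inner sum of modulus at
  most 1. This is the bound free of N that the tail needs.\<close>

lemma norm_kloosterman_level_le:
  fixes N m :: nat and h j :: int
  assumes "squarefree N" "coprime m N" "j > 0"
  shows "norm (kloosterman m (h * N) (j * N)) \<le> j"
proof -
  let ?A = "{a\<in>{0..<j}. coprime a j}"
  have "N > 0" using assms by (auto intro: Nat.gr0I)
  have "norm (kloosterman m (h * N) (j * N)) \<le> real (card ?A) * 1"
    unfolding kloosterman_level[OF \<open>N > 0\<close> assms(3)]
    by (rule sum_norm_bound) (use norm_sum_coprime_add_char_le[OF assms(1,2)] in \<open>auto simp: norm_mult\<close>)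
  also have "card ?A \<le> card {0..<j}" by (intro card_mono) auto
  finally show ?thesis using assms by simp
qed

text \<open>For j = 1 the condition N dvd a + j s becomes N dvd s and leaves s = 0 alone, so the sum
  collapses to the sign from inclusion-exclusion.\<close>

lemma norm_kloosterman_level_1:
  fixes N m :: nat and h :: int
  assumes "squarefree N" "coprime m N"
  shows "norm (kloosterman m (h * N) N) = 1"
proof -
  have "N > 0" using assms by (auto intro: Nat.gr0I)
  have "{a\<in>{0..<1::int}. coprime a 1} = {0}" by auto
  moreover have "{s\<in>{0..<int N}. int N dvd s} = {0}"
    using \<open>N > 0\<close> by (auto dest: zdvd_imp_le)
  ultimately show ?thesis
    using kloosterman_level[OF \<open>N > 0\<close>, of 1 m h] sum_coprime_add_char[OF assms, of 0 1]
    by (simp add: norm_mult norm_power)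
qed

subsection \<open>Cosets and absolute convergence\<close>

definition bottom_row :: "mat2 \<Rightarrow> int \<times> int" where
  "bottom_row = (\<lambda>(a, b, c, d). (c, d))"

definition bottom_rows :: "nat \<Rightarrow> (int \<times> int) set" where
  "bottom_rows N = {(c, d). coprime c d \<and> int N dvd c}"

definition fiber :: "nat \<Rightarrow> int \<times> int \<Rightarrow> mat2 set" where
  "fiber N q = {\<gamma> \<in> Gamma0 N. bottom_row \<gamma> = q}"

text \<open>Two matrices of determinant 1 with equal bottom row differ by a translation on the left.
  Thus cosets are pairs (c, d); (c, d) and (-c, -d) stay different, as \<open>Gamma_inf\<close> does
  not contain -1.\<close>

lemma orbit_eq_fiber:
  assumes "\<gamma> \<in> Gamma0 N"
  shows "(\<lambda>g. mmult g \<gamma>) ` Gamma_inf = fiber N (bottom_row \<gamma>)"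
proof -
  obtain a b c d where \<gamma>: "\<gamma> = (a, b, c, d)" by (metis prod_cases4)
  have det: "a * d - b * c = 1" and c: "int N dvd c"
    using assms by (auto simp: \<gamma> Gamma0_def)
  have "mmult (1, t, 0, 1) \<gamma> \<in> fiber N (bottom_row \<gamma>)" for t
    using det c by (auto simp: \<gamma> mmult_def fiber_def Gamma0_def bottom_row_def algebra_simps)
  moreover have "\<gamma>' \<in> (\<lambda>g. mmult g \<gamma>) ` Gamma_inf" if "\<gamma>' \<in> fiber N (bottom_row \<gamma>)" for \<gamma>'
  proof -
    obtain a' b' c' d' where *: "\<gamma>' = (a', b', c', d')" by (metis prod_cases4)
    then have \<gamma>': "\<gamma>' = (a', b', c, d)" and det': "a' * d - b' * c = 1"
      using that by (auto simp: \<gamma> fiber_def Gamma0_def bottom_row_def)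
    \<comment> \<open>The upper right entry of \<gamma>' \<gamma>^(-1). The two identities below are
      arranged so that both determinant equations can be inserted.\<close>
    define t where "t = a * b' - a' * b"
    have "a + t * c = a * (1 - (a' * d - b' * c)) + a' * (a * d - b * c)"
      by (simp add: t_def algebra_simps)
    then have 1: "a + t * c = a'" by (simp add: det det')
    have "b + t * d = b * (1 - (a' * d - b' * c)) + b' * (a * d - b * c)"
      by (simp add: t_def algebra_simps)
    then have 2: "b + t * d = b'" by (simp add: det det')
    have "\<gamma>' = mmult (1, t, 0, 1) \<gamma>"
      using 1 2 by (simp add: \<gamma> \<gamma>' mmult_def)
    then show ?thesis by (auto simp: Gamma_inf_def)
  qed
  ultimately show ?thesis by (auto simp: Gamma_inf_def)
qed

lemma bottom_row_image_Gamma0: "bottom_row ` Gamma0 N = bottom_rows N"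
proof
  show "bottom_row ` Gamma0 N \<subseteq> bottom_rows N"
  proof
    fix q assume "q \<in> bottom_row ` Gamma0 N"
    then obtain a b c d where q: "q = (c, d)" "a * d - b * c = 1" "int N dvd c"
      by (auto simp: Gamma0_def bottom_row_def)
    have "coprime c d"
    proof (rule coprimeI)
      fix x assume "x dvd c" "x dvd d"
      then have "x dvd a * d - b * c" by simp
      then show "is_unit x" using q by simp
    qed
    then show "q \<in> bottom_rows N" using q by (simp add: bottom_rows_def)
  qed
  show "bottom_rows N \<subseteq> bottom_row ` Gamma0 N"
  proof
    fix q assume "q \<in> bottom_rows N"
    then obtain c d where q: "q = (c, d)" "coprime c d" "int N dvd c"
      by (auto simp: bottom_rows_def)
    obtain u v where "u * c + v * d = 1"
      using q(2) bezout_int[of c d] by (auto simp: coprime_iff_gcd_eq_1)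
    then have "(v, - u, c, d) \<in> Gamma0 N"
      using q by (simp add: Gamma0_def algebra_simps)
    then show "q \<in> bottom_row ` Gamma0 N"
      using q(1) by (force simp: bottom_row_def)
  qed
qed

lemma bij_betw_fiber: "bij_betw (fiber N) (bottom_rows N) (cosets N)"
proof (rule bij_betwI')
  fix q q' assume q: "q \<in> bottom_rows N" and "q' \<in> bottom_rows N"
  from q obtain \<gamma> where "\<gamma> \<in> Gamma0 N" "bottom_row \<gamma> = q"
    unfolding bottom_row_image_Gamma0[symmetric] by blast
  then show "(fiber N q = fiber N q') \<longleftrightarrow> q = q'"
    by (auto simp: fiber_def)
next
  fix q assume "q \<in> bottom_rows N"
  then show "fiber N q \<in> cosets N"
    unfolding bottom_row_image_Gamma0[symmetric] cosets_def using orbit_eq_fiber by auto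
next
  fix X assume "X \<in> cosets N"
  then show "\<exists>q\<in>bottom_rows N. X = fiber N q"
    unfolding bottom_row_image_Gamma0[symmetric] cosets_def using orbit_eq_fiber by auto
qed

text \<open>From \<open>(a z + b) / (c z + d) = a / c - 1 / (c (c z + d))\<close>, where only \<open>a\<close> modulo \<open>c\<close> matters.\<close>

definition poincare_summand :: "nat \<Rightarrow> nat \<Rightarrow> int \<Rightarrow> int \<Rightarrow> complex \<Rightarrow> complex" where
  "poincare_summand k m c d z =
    (if c = 0 then e (of_nat m * z)
     else add_char c (int m * modular_inverse c d) *
       e (- (of_nat m / (of_int c * (of_int c * z + of_int d)))) / (of_int c * z + of_int d) ^ k)"

lemma cocycle_nonzero: "Im z > 0 \<Longrightarrow> c \<noteq> 0 \<Longrightarrow> of_int c * z + of_int d \<noteq> (0 :: complex)"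
  by (auto simp: complex_eq_iff)

text \<open>Inverses of d modulo c agree modulo c, so the upper left entry of any representative may
  be traded for \<open>modular_inverse\<close>. Negative c is included.\<close>

lemma add_char_inverse_cong:
  assumes "coprime c d" "[a * d = 1] (mod c)"
  shows "add_char c (m * a) = add_char c (m * modular_inverse c d)"
proof (intro add_char_cong cong_mult cong_refl)
  have "[modular_inverse c d * (a * d) = modular_inverse c d * 1] (mod c)"
    by (intro cong_mult cong_refl assms)
  moreover have "[a * (modular_inverse c d * d) = a * 1] (mod c)"
    using assms by (intro cong_mult cong_refl cong_modular_inverse2) (simp add: coprime_commute)
  ultimately show "[a = modular_inverse c d] (mod c)"
    by (simp add: cong_def mult_ac)
qed

lemma poincare_term_eq_summand:
  assumes "\<gamma> \<in> fiber N (c, d)" "even k" "Im z > 0"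
  shows "poincare_term k m \<gamma> z = poincare_summand k m c d z"
proof -
  obtain a b where \<gamma>: "\<gamma> = (a, b, c, d)" and det: "a * d - b * c = 1"
    using assms by (auto simp: fiber_def Gamma0_def bottom_row_def)
  show ?thesis
  proof (cases "c = 0")
    case True
    then have "a * d = 1" using det by simp
    then have "(a = 1 \<and> d = 1) \<or> (a = - 1 \<and> d = - 1)"
      by (simp add: zmult_eq_1_iff)
    \<comment> \<open>With a = d = 1 or a = d = -1 the map is translation by a b, and the even
      weight removes the sign of d.\<close>
    then have "moebius \<gamma> z = z + of_int (a * b)" and d: "of_int d ^ k = (1::complex)"
      using True \<open>even k\<close> by (auto simp: moebius_def \<gamma>)
    define t where "t = a * b"
    have "moebius \<gamma> z = z + of_int t" unfolding t_def by fact
    have "e (of_nat m * (z + of_int t)) = e (of_nat m * z) * e (of_int (int m * t))"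
      by (simp add: e_add[symmetric] distrib_left)
    also have "\<dots> = e (of_nat m * z)"
      by (simp only: e_of_int mult_1_right)
    finally show ?thesis
      using True d \<open>moebius \<gamma> z = z + of_int t\<close>
      by (simp add: poincare_term_def poincare_summand_def j_fac_def \<gamma> power_int_minus)
  next
    case False
    let ?w = "of_int c * z + of_int d"
    have w: "?w \<noteq> 0" using assms False by (intro cocycle_nonzero) auto
    have "of_int (a * d - b * c) = (1 :: complex)" by (simp only: det of_int_1)
    then have det': "of_int a * of_int d - of_int b * of_int c = (1 :: complex)" by simp
    have *: "(of_int a * z + of_int b) * of_int c = of_int a * ?w - (of_int a * of_int d - of_int b * of_int c)"
      by (simp add: algebra_simps)
    have mb: "moebius \<gamma> z = of_int a / of_int c - 1 / (of_int c * ?w)"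
    proof -
      obtain v where v: "?w = v" by blast
      have "(of_int a * z + of_int b) * of_int c = of_int a * v - 1"
        using * by (simp only: det' v)
      then have "of_int a * z + of_int b = (of_int a * v - 1) / of_int c"
        using False by (simp add: nonzero_eq_divide_eq)
      then have "moebius \<gamma> z = (of_int a * v - 1) / of_int c / v"
        by (simp add: moebius_def \<gamma> v)
      then show ?thesis
        using w False unfolding v by (simp add: diff_divide_distrib)
    qed
    have "e (of_nat m * moebius \<gamma> z) = e (of_int (int m * a) / of_int c + - (of_nat m / (of_int c * ?w)))"
      by (simp add: mb right_diff_distrib)
    also have "\<dots> = add_char c (int m * a) * e (- (of_nat m / (of_int c * ?w)))"
      unfolding e_add add_char_def ..
    also have "add_char c (int m * a) = add_char c (int m * modular_inverse c d)"
    proof (rule add_char_inverse_cong)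
      have "a * d = 1 + b * c" using det by simp
      then show "[a * d = 1] (mod c)" by (simp add: cong_def)
      have "(c, d) \<in> bottom_row ` Gamma0 N" using assms by (force simp: fiber_def)
      then show "coprime c d" by (simp add: bottom_row_image_Gamma0 bottom_rows_def)
    qed
    finally show ?thesis
      using False by (simp add: poincare_term_def poincare_summand_def j_fac_def \<gamma> power_int_minus field_simps)
  qed
qed

lemma poincare_eq_infsum:
  assumes "even k" "Im z > 0"
  shows "poincare k m N z = (\<Sum>\<^sub>\<infinity>(c, d)\<in>bottom_rows N. poincare_summand k m c d z)"
proof -
  have "poincare k m N z = (\<Sum>\<^sub>\<infinity>q\<in>bottom_rows N. poincare_term k m (SOME \<gamma>. \<gamma> \<in> fiber N q) z)"
    unfolding poincare_def by (rule infsum_reindex_bij_betw[OF bij_betw_fiber, symmetric])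
  also have "\<dots> = (\<Sum>\<^sub>\<infinity>(c, d)\<in>bottom_rows N. poincare_summand k m c d z)"
  proof (intro infsum_cong, clarify)
    fix c d assume "(c, d) \<in> bottom_rows N"
    then have "\<exists>\<gamma>. \<gamma> \<in> fiber N (c, d)"
      unfolding bottom_row_image_Gamma0[symmetric] by (force simp: fiber_def)
    then show "poincare_term k m (SOME \<gamma>. \<gamma> \<in> fiber N (c, d)) z = poincare_summand k m c d z"
      by (intro poincare_term_eq_summand assms) (rule someI_ex)
  qed
  finally show ?thesis .
qed

text \<open>The row (-c, -d) belongs to -\<gamma>, which acts on the half plane as \<gamma> does; an
  even k absorbs the sign of the cocycle. Negative c can therefore be folded onto positive
  c.\<close>

lemma poincare_summand_uminus:
  assumes "even k" "coprime c d"
  shows "poincare_summand k m (- c) (- d) z = poincare_summand k m c d z"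
proof (cases "c = 0")
  case False
  have "add_char c (int m * - modular_inverse (- c) (- d)) = add_char c (int m * modular_inverse c d)"
  proof (rule add_char_inverse_cong)
    have "[modular_inverse (- c) (- d) * (- d) = 1] (mod (- c))"
      using assms by (intro cong_modular_inverse2) (simp add: coprime_commute)
    then show "[- modular_inverse (- c) (- d) * d = 1] (mod c)" by simp
  qed fact
  then have "add_char (- c) (int m * modular_inverse (- c) (- d)) = add_char c (int m * modular_inverse c d)"
    by (simp add: add_char_def)
  moreover obtain w where w: "of_int c * z + of_int d = w" by blast
  moreover have "of_int (- c) * z + of_int (- d) = - w"
    by (simp add: w[symmetric])
  ultimately show ?thesis
    unfolding poincare_summand_def using False assms by (simp only:) (simp add: power_minus_even)
qed (simp add: poincare_summand_def)

text \<open>At height 1, q = |c z + d|^2 = (c x + d)^2 + c^2 dominates 1, c^2 and d^2 / 2, so 1 +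
  c^2 <= 2 q and 1 + d^2 <= 3 q. The product form makes the majorant summable in c and d separately,
  at the price of a fourth power, whence k >= 4 below.\<close>

lemma norm_cocycle_ge:
  fixes c d :: int and x :: real
  assumes "coprime c d" "0 \<le> x" "x \<le> 1"
  defines "w \<equiv> norm (of_int c * (of_real x + \<i>) + of_int d)"
  shows "(1 + (of_int c)\<^sup>2) * (1 + (of_int d)\<^sup>2) \<le> 6 * w ^ 4" "w \<ge> 1"
proof -
  let ?c = "of_int c :: real" and ?d = "of_int d :: real"
  let ?q = "(?c * x + ?d)\<^sup>2 + ?c\<^sup>2"
  have w2: "w\<^sup>2 = ?q"
    unfolding w_def cmod_power2 by (simp add: algebra_simps)
  have c1: "?c\<^sup>2 \<le> ?q" by simp
  have "(?c * x)\<^sup>2 \<le> ?c\<^sup>2"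
    using assms by (simp add: power_mult_distrib mult_left_le power_le_one)
  moreover have "?d\<^sup>2 \<le> 2 * (?c * x + ?d)\<^sup>2 + 2 * (?c * x)\<^sup>2"
    using zero_le_power2[of "2 * (?c * x) + ?d"] by (simp add: power2_eq_square algebra_simps)
  ultimately have d1: "?d\<^sup>2 \<le> 2 * ?q" by simp
  have q1: "?q \<ge> 1"
  proof (cases "c = 0")
    case True
    then have "\<bar>d\<bar> = 1" using assms by simp
    then have "d ^ 2 = 1" by (metis power2_abs one_power2)
    then show ?thesis using True by (simp flip: of_int_power)
  next
    case False
    then have "1 \<le> c ^ 2" by (simp add: power2_eq_square) (metis False zero_less_mult_iff mult_eq_0_iff not_square_less_zero linorder_neqE int_one_le_iff_zero_less)
    then have "1 \<le> ?c\<^sup>2" by (simp flip: of_int_power)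
    then show ?thesis using c1 by linarith
  qed
  then show "w \<ge> 1"
    using w2 by (intro power2_le_imp_le[of 1 w]) (auto simp: w_def)
  have "1 + ?c\<^sup>2 \<le> 2 * ?q"
    using add_mono[OF q1 c1] by (simp only: mult_2)
  moreover have "1 + ?d\<^sup>2 \<le> 3 * ?q"
    using add_mono[OF q1 d1] by (simp add: algebra_simps)
  ultimately have "(1 + ?c\<^sup>2) * (1 + ?d\<^sup>2) \<le> (2 * ?q) * (3 * ?q)"
    by (rule mult_mono) simp_all
  also have "(2 * q) * (3 * q) = 6 * q\<^sup>2" for q :: real by (simp add: power2_eq_square)
  then have "(2 * ?q) * (3 * ?q) = 6 * (w\<^sup>2)\<^sup>2" by (simp only: w2)
  finally show "(1 + ?c\<^sup>2) * (1 + ?d\<^sup>2) \<le> 6 * w ^ 4" by (simp add: power_mult[symmetric])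
qed

lemma norm_poincare_summand_le:
  assumes "coprime c d" "0 \<le> x" "x \<le> 1" "k \<ge> 4"
  shows "norm (poincare_summand k m c d (of_real x + \<i>)) \<le> 6 / ((1 + (of_int c)\<^sup>2) * (1 + (of_int d)\<^sup>2))"
proof -
  let ?z = "of_real x + \<i>"
  let ?w = "of_int c * ?z + of_int d"
  let ?p = "(1 + (of_int c)\<^sup>2) * (1 + (of_int d)\<^sup>2) :: real"
  have p: "?p > 0" by (intro mult_pos_pos) (simp_all add: add_pos_nonneg)
  note w = norm_cocycle_ge[OF assms(1-3)]
  have le: "1 / norm ?w ^ k \<le> 6 / ?p"
  proof -
    have "?p \<le> 6 * norm ?w ^ 4" by (rule w)
    also have "\<dots> \<le> 6 * norm ?w ^ k" using w assms by (intro mult_left_mono power_increasing) auto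
    finally show ?thesis using p w(2) by (simp add: field_simps)
  qed
  show ?thesis
  proof (cases "c = 0")
    case True
    then have "\<bar>d\<bar> = 1" using assms by simp
    then have "norm ?w = 1" using True by (simp flip: of_int_abs)
    then have "1 \<le> 6 / ?p" using le by simp
    moreover have "norm (poincare_summand k m c d ?z) \<le> 1"
      using True by (simp add: poincare_summand_def norm_e)
    ultimately show ?thesis by linarith
  next
    case False
    \<comment> \<open>This is m times the imaginary part of \<gamma> z, hence nonnegative, and the
      exponential has modulus at most 1.\<close>
    have "Im (- (of_nat m / (of_int c * ?w))) = of_nat m * (1 / (norm ?w)\<^sup>2)"
    proof -
      have "- (of_nat m / (of_int c * ?w)) = of_real (- (of_nat m / of_int c)) * (1 / ?w)"
        using False by simp
      also have "Im \<dots> = - (of_nat m / of_int c) * Im (1 / ?w)"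
        by (simp only: Im_complex_of_real Re_complex_of_real times_complex.simps)
      also have "Im (1 / ?w) = - of_int c / (norm ?w)\<^sup>2"
        by (simp add: Im_divide cmod_power2)
      finally show ?thesis using False by simp
    qed
    then have "norm (e (- (of_nat m / (of_int c * ?w)))) \<le> 1"
      by (simp add: norm_e)
    then have "norm (poincare_summand k m c d ?z) \<le> 1 / norm ?w ^ k"
      using False by (simp add: poincare_summand_def norm_mult norm_divide norm_power divide_right_mono)
    then show ?thesis using le by linarith
  qed
qed

lemma continuous_on_poincare_summand:
  assumes "\<And>x. x \<in> S \<Longrightarrow> Im (g x) > 0" "continuous_on S g"
  shows "continuous_on S (\<lambda>x. poincare_summand k m c d (g x))"
proof (cases "c = 0")
  case True
  then show ?thesis
    unfolding poincare_summand_def e_def using assms by (auto intro!: continuous_intros)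
next
  case False
  then have "of_int c * g x + of_int d \<noteq> 0" if "x \<in> S" for x
    using cocycle_nonzero assms that by blast
  then show ?thesis
    unfolding poincare_summand_def e_def using assms False by (auto intro!: continuous_intros)
qed

lemma summable_on_int_inverse_square: "(\<lambda>n::int. 1 / (1 + (of_int n)\<^sup>2) :: real) summable_on UNIV"
proof -
  let ?f = "\<lambda>n::int. 1 / (1 + (of_int n)\<^sup>2) :: real"
  have "summable (\<lambda>n::nat. 1 / (1 + (real n)\<^sup>2))"
  proof (rule summable_comparison_test_ev)
    show "summable (\<lambda>n. 1 / real n ^ 2)"
      using inverse_power_summable[of 2, where 'a=real] by (simp add: field_simps)
    show "\<forall>\<^sub>F n in sequentially. norm (1 / (1 + (real n)\<^sup>2)) \<le> 1 / real n ^ 2"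
      using eventually_gt_at_top[of 0] by eventually_elim (auto intro!: divide_left_mono mult_pos_pos add_pos_nonneg)
  qed
  then have nat: "(\<lambda>n::nat. 1 / (1 + (real n)\<^sup>2)) summable_on UNIV"
    by (intro norm_summable_imp_summable_on) simp
  have "?f summable_on range int"
    using nat by (subst summable_on_reindex) (auto simp: o_def)
  moreover have "?f summable_on range (\<lambda>n. - int n)"
    using nat by (subst summable_on_reindex) (auto simp: o_def inj_on_def)
  ultimately have "?f summable_on range int \<union> range (\<lambda>n. - int n)"
    by (rule summable_on_union)
  moreover have "range int \<union> range (\<lambda>n. - int n) = UNIV"
    by (metis (no_types, lifting) Un_iff rangeI UNIV_eq_I int_cases2)
  ultimately show ?thesis by simp
qed

lemma summable_on_int_pairs:
  "(\<lambda>(c, d). 6 / ((1 + (of_int c)\<^sup>2) * (1 + (of_int d)\<^sup>2)) :: real) summable_on (UNIV :: (int \<times> int) set)"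
proof -
  let ?f = "\<lambda>n::int. 1 / (1 + (of_int n)\<^sup>2) :: real"
  have "(\<lambda>(c, d). 6 * ?f c * ?f d) summable_on (SIGMA c:UNIV. UNIV)"
  proof (rule summable_on_SigmaI)
    show "((\<lambda>d. case (c, d) of (c, d) \<Rightarrow> 6 * ?f c * ?f d) has_sum 6 * ?f c * infsum ?f UNIV) UNIV" for c
      using summable_on_int_inverse_square by (simp add: has_sum_cmult_right has_sum_infsum del: times_divide_eq_left times_divide_eq_right)
    show "(\<lambda>c. 6 * ?f c * infsum ?f UNIV) summable_on UNIV"
      by (intro summable_on_cmult_left summable_on_cmult_right summable_on_int_inverse_square)
  qed simp
  then show ?thesis by (simp add: case_prod_unfold)
qed

definition summand_coeff :: "nat \<Rightarrow> nat \<Rightarrow> nat \<Rightarrow> int \<Rightarrow> int \<Rightarrow> complex" where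
  "summand_coeff k m n c d = fourier_coeff (poincare_summand k m c d) n"

lemma summand_integrand_le:
  assumes "coprime c d" "0 \<le> x" "x \<le> 1" "k \<ge> 4"
  shows "norm (poincare_summand k m c d (of_real x + \<i>) * e (- of_nat n * (of_real x + \<i>)))
    \<le> 6 / ((1 + (of_int c)\<^sup>2) * (1 + (of_int d)\<^sup>2)) * exp (2 * pi * n)"
proof -
  have "norm (e (- of_nat n * (of_real x + \<i>))) = exp (2 * pi * n)"
    by (simp add: norm_e)
  then show ?thesis
    unfolding norm_mult by (simp only: mult_right_mono[OF norm_poincare_summand_le[OF assms]] exp_ge_zero)
qed

lemma summand_integrand_integrable:
  "(\<lambda>x. poincare_summand k m c d (of_real x + \<i>) * e (- of_nat n * (of_real x + \<i>))) integrable_on {0..1}"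
  unfolding e_def by (intro integrable_continuous_interval continuous_intros continuous_on_poincare_summand) auto

text \<open>Taken over all coprime pairs, so that each subfamily used later (level N, a single c, a
  residue class of d) inherits summability by restriction.\<close>

lemma summable_on_summand_coeff:
  assumes "k \<ge> 4"
  shows "(\<lambda>(c, d). summand_coeff k m n c d) summable_on {(c, d). coprime c d}"
proof (rule abs_summable_summable, rule Infinite_Sum.abs_summable_on_comparison_test')
  show "(\<lambda>(c, d). 6 / ((1 + (of_int c)\<^sup>2) * (1 + (of_int d)\<^sup>2)) * exp (2 * pi * n)) summable_on {(c, d). coprime c d}"
    using summable_on_cmult_left[OF summable_on_subset_banach[OF summable_on_int_pairs, of "{(c, d). coprime c d}"], of "exp (2 * pi * n)"]
    by (simp add: case_prod_unfold)
  fix q assume "q \<in> {(c::int, d). coprime c d}"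
  then obtain c d where q: "q = (c, d)" "coprime c d" by auto
  have "norm (summand_coeff k m n c d) \<le> 6 / ((1 + (of_int c)\<^sup>2) * (1 + (of_int d)\<^sup>2)) * exp (2 * pi * n) * (1 - 0)"
    unfolding summand_coeff_def fourier_coeff_def
  proof (rule integral_bound)
    show "continuous_on {0..1} (\<lambda>x. poincare_summand k m c d (of_real x + \<i>) * e (- of_nat n * (of_real x + \<i>)))"
      unfolding e_def by (intro continuous_intros continuous_on_poincare_summand) auto
    show "norm (poincare_summand k m c d (of_real x + \<i>) * e (- of_nat n * (of_real x + \<i>)))
        \<le> 6 / ((1 + (of_int c)\<^sup>2) * (1 + (of_int d)\<^sup>2)) * exp (2 * pi * n)" if "x \<in> {0..1}" for x
      by (rule summand_integrand_le) (use q assms that in auto)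
  qed simp
  then show "norm (case q of (c, d) \<Rightarrow> summand_coeff k m n c d)
      \<le> (case q of (c, d) \<Rightarrow> 6 / ((1 + (of_int c)\<^sup>2) * (1 + (of_int d)\<^sup>2)) * exp (2 * pi * n))"
    by (simp add: q)
qed

subsection \<open>Unfolding\<close>

text \<open>The majorant does not depend on x, so the M-test gives uniform convergence on the
  segment along finite sets of rows, and integration may be done termwise.\<close>

lemma has_sum_summand_coeff:
  assumes "k \<ge> 4" "even k"
  shows "((\<lambda>(c, d). summand_coeff k m n c d) has_sum fourier_coeff (poincare k m N) n) (bottom_rows N)"
proof -
  let ?Q = "bottom_rows N"
  let ?E = "\<lambda>x. e (- of_nat n * (of_real x + \<i>))"
  define G where "G = (\<lambda>q x. if q \<in> ?Q then (case q of (c, d) \<Rightarrow> poincare_summand k m c d (of_real x + \<i>)) * ?E x else 0)"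
  have int: "(\<lambda>x. G q x) integrable_on {0..1}" if "q \<in> ?Q" for q
    using that summand_integrand_integrable by (cases q) (simp add: G_def)
  have ul: "uniform_limit {0..1} (\<lambda>X x. \<Sum>q\<in>X. G q x) (\<lambda>x. \<Sum>\<^sub>\<infinity>q\<in>?Q. G q x) (finite_subsets_at_top ?Q)"
  proof (rule Weierstrass_m_test_general)
    show "(\<lambda>(c, d). 6 / ((1 + (of_int c)\<^sup>2) * (1 + (of_int d)\<^sup>2)) * exp (2 * pi * n)) summable_on ?Q"
      using summable_on_cmult_left[OF summable_on_subset_banach[OF summable_on_int_pairs, of ?Q], of "exp (2 * pi * n)"]
      by (simp add: case_prod_unfold)
    fix q x assume "q \<in> ?Q" "x \<in> {0..1::real}"
    then show "norm (G q x) \<le> (case q of (c, d) \<Rightarrow> 6 / ((1 + (of_int c)\<^sup>2) * (1 + (of_int d)\<^sup>2)) * exp (2 * pi * n))"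
      using summand_integrand_le[of "fst q" "snd q" x k m n] assms
      by (auto simp: G_def bottom_rows_def split: prod.splits)
  qed
  have cont: "continuous_on {0..1} (\<lambda>x. \<Sum>q\<in>X. G q x)" for X
  proof (rule continuous_on_sum)
    fix q
    show "continuous_on {0..1} (G q)"
    proof (cases "q \<in> ?Q")
      case True
      then show ?thesis
        unfolding G_def e_def
        by (cases q) (auto intro!: continuous_intros continuous_on_poincare_summand)
    next
      case False
      then show ?thesis by (simp add: G_def)
    qed
  qed
  obtain I J where I: "\<And>X. ((\<lambda>x. \<Sum>q\<in>X. G q x) has_integral I X) {0..1}"
    and J: "((\<lambda>x. \<Sum>\<^sub>\<infinity>q\<in>?Q. G q x) has_integral J) {0..1}"
    and lim: "(I \<longlongrightarrow> J) (finite_subsets_at_top ?Q)"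
    using uniform_limit_integral[OF ul cont] by (metis finite_subsets_at_top_neq_bot)
  have "(\<Sum>\<^sub>\<infinity>q\<in>?Q. G q x) = poincare k m N (of_real x + \<i>) * ?E x" for x
  proof -
    have "(\<Sum>\<^sub>\<infinity>q\<in>?Q. G q x) = (\<Sum>\<^sub>\<infinity>q\<in>?Q. (case q of (c, d) \<Rightarrow> poincare_summand k m c d (of_real x + \<i>)) * ?E x)"
      by (rule infsum_cong) (simp add: G_def)
    also have "\<dots> = (\<Sum>\<^sub>\<infinity>(c, d)\<in>?Q. poincare_summand k m c d (of_real x + \<i>)) * ?E x"
      by (rule infsum_cmult_left')
    also have "(\<Sum>\<^sub>\<infinity>(c, d)\<in>?Q. poincare_summand k m c d (of_real x + \<i>)) = poincare k m N (of_real x + \<i>)"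
      by (rule poincare_eq_infsum[symmetric]) (use assms in auto)
    finally show ?thesis .
  qed
  then have "J = fourier_coeff (poincare k m N) n"
    using J by (simp add: fourier_coeff_def has_integral_iff)
  moreover have "I X = (\<Sum>(c, d)\<in>X. summand_coeff k m n c d)" if "finite X" "X \<subseteq> ?Q" for X
  proof -
    have "I X = integral {0..1} (\<lambda>x. \<Sum>q\<in>X. G q x)"
      using I by (simp add: has_integral_iff)
    also have "\<dots> = (\<Sum>q\<in>X. integral {0..1} (G q))"
      using int that by (intro integral_sum) auto
    also have "\<dots> = (\<Sum>(c, d)\<in>X. summand_coeff k m n c d)"
      using that by (intro sum.cong) (auto simp: G_def summand_coeff_def fourier_coeff_def subset_iff)
    finally show ?thesis .
  qed
  then have "(I \<longlongrightarrow> J) (finite_subsets_at_top ?Q) \<longleftrightarrow>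
      (sum (\<lambda>(c, d). summand_coeff k m n c d) \<longlongrightarrow> J) (finite_subsets_at_top ?Q)"
    by (intro filterlim_cong refl eventually_finite_subsets_at_top_weakI) auto
  ultimately show ?thesis using lim by (simp add: has_sum_def)
qed

text \<open>Orthogonality of distinct exponentials over a period. This disposes of the diagonal term
  when m and n differ.\<close>

lemma summand_coeff_0:
  assumes "m \<noteq> n"
  shows "summand_coeff k m n 0 d = 0"
proof -
  define l where "l = (of_int (int m - int n) :: complex)"
  have l: "l \<noteq> 0" using assms by (simp add: l_def)
  define w where "w = 2 * of_real pi * \<i> * l"
  have w: "w \<noteq> 0" using l by (simp add: w_def)
  have eq: "poincare_summand k m 0 d (of_real x + \<i>) * e (- of_nat n * (of_real x + \<i>)) = exp (w * (of_real x + \<i>))" for x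
    by (simp add: poincare_summand_def e_def exp_add[symmetric] w_def l_def algebra_simps)
  have "((\<lambda>x. exp (w * (of_real x + \<i>))) has_integral
      (exp (w * (of_real 1 + \<i>)) / w - exp (w * (of_real 0 + \<i>)) / w)) {0..1}"
  proof (rule fundamental_theorem_of_calculus)
    fix x :: real
    have "((\<lambda>z. exp (w * (z + \<i>)) / w) has_field_derivative exp (w * (of_real x + \<i>))) (at (of_real x))"
      using w by (auto intro!: derivative_eq_intros)
    then show "((\<lambda>x. exp (w * (of_real x + \<i>)) / w) has_vector_derivative exp (w * (of_real x + \<i>))) (at x within {0..1})"
      by (rule has_vector_derivative_real_field)
  qed simp
  moreover have "exp (w * (of_real 1 + \<i>)) = exp (w * (of_real 0 + \<i>))"
  proof -
    have "exp w = e (of_int (int m - int n))" by (simp only: e_def w_def l_def)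
    then have "exp w = 1" by (simp only: e_of_int)
    then show ?thesis by (simp add: distrib_left exp_add)
  qed
  ultimately show ?thesis
    unfolding summand_coeff_def fourier_coeff_def eq by (simp add: has_integral_iff)
qed

text \<open>The intervals [t, t + 1] with -T <= t < T tile [-T, T], hence the half-open index range;
  the induction adds one interval at each end.\<close>

lemma sum_integral_unit_intervals:
  fixes h :: "real \<Rightarrow> complex"
  assumes h: "continuous_on UNIV h"
  shows "(\<Sum>t\<in>{- int T..<int T}. integral {0..1} (\<lambda>x. h (x + of_int t))) = integral {- real T..real T} h"
proof (induction T)
  case (Suc T)
  have int: "h integrable_on {a..b}" for a b
    by (intro integrable_continuous_interval continuous_on_subset[OF h]) auto
  have unit: "integral {0..1} (\<lambda>x. h (x + a)) = integral {a..a + 1} h" for a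
    using integral_shift_Icc_real[of 0 1 h a] by (simp add: o_def add.commute)
  have "{- int (Suc T)..<int (Suc T)} = {- int T..<int T} \<union> {- int T - 1, int T}"
    by auto
  moreover have "- int T - 1 \<noteq> int T" by linarith
  ultimately have "(\<Sum>t\<in>{- int (Suc T)..<int (Suc T)}. integral {0..1} (\<lambda>x. h (x + of_int t))) =
      integral {- real T - 1..- real T} h + integral {- real T..real T} h + integral {real T..real T + 1} h"
    by (simp add: sum.union_disjoint Suc.IH unit[of "- real T - 1", simplified] unit[of "real T", simplified])
  also have "\<dots> = integral {- real T - 1..real T + 1} h"
    using Henstock_Kurzweil_Integration.integral_combine[where f = h and a = "- real T - 1" and c = "- real T" and b = "real T"]
      Henstock_Kurzweil_Integration.integral_combine[where f = h and a = "- real T - 1" and c = "real T" and b = "real T + 1"] int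
    by simp
  also have "{- real T - 1..real T + 1} = {- real (Suc T)..real (Suc T)}"
    by (rule arg_cong2[of _ _ _ _ atLeastAtMost]) simp_all
  finally show ?case .
qed simp

text \<open>An unconditional sum may be evaluated along any exhausting sequence of finite sets. The
  one chosen here matches the symmetric truncation of the line integral.\<close>

lemma infsum_int_eq_limit:
  fixes g :: "int \<Rightarrow> 'a :: {t2_space, topological_comm_monoid_add}"
  assumes "g summable_on UNIV" "(\<lambda>T::nat. \<Sum>t\<in>{- int T..<int T}. g t) \<longlonglongrightarrow> L"
  shows "infsum g UNIV = L"
proof -
  have "(sum g \<longlongrightarrow> infsum g UNIV) (finite_subsets_at_top UNIV)"
    using has_sum_infsum[OF assms(1)] by (simp add: has_sum_def)
  moreover have "filterlim (\<lambda>T::nat. {- int T..<int T}) (finite_subsets_at_top UNIV) sequentially"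
    unfolding filterlim_finite_subsets_at_top
  proof (intro allI impI)
    fix X :: "int set" assume X: "finite X \<and> X \<subseteq> UNIV"
    define M where "M = nat (Max (insert 0 (abs ` X))) + 1"
    have M: "\<bar>x\<bar> < int M" if "x \<in> X" for x
    proof -
      have "\<bar>x\<bar> \<le> Max (insert 0 (abs ` X))" using X that by (intro Max_ge) auto
      then show ?thesis unfolding M_def by linarith
    qed
    show "\<forall>\<^sub>F T in sequentially. finite {- int T..<int T} \<and> X \<subseteq> {- int T..<int T} \<and> {- int T..<int T} \<subseteq> UNIV"
      using eventually_ge_at_top[of M] by (rule eventually_mono) (use M in fastforce)
  qed
  ultimately have "(\<lambda>T::nat. \<Sum>t\<in>{- int T..<int T}. g t) \<longlonglongrightarrow> infsum g UNIV"
    by (rule filterlim_compose)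
  then show ?thesis using assms(2) LIMSEQ_unique by blast
qed

text \<open>The summand of row (c, d) times e(-n z), in the variable w = z + d / c and stripped of
  all factors independent of w.\<close>

definition line_kernel :: "nat \<Rightarrow> nat \<Rightarrow> nat \<Rightarrow> int \<Rightarrow> complex \<Rightarrow> complex" where
  "line_kernel k m n c z =
     exp (- \<i> * of_real (2 * pi * m / (of_int c)\<^sup>2) / z + - \<i> * of_real (2 * pi * n) * z) / z ^ k"

lemma coprime_add_mult_self_iff: "coprime c (r + c * t) \<longleftrightarrow> coprime c (r :: int)"
  by (metis coprime_iff_gcd_eq_1 gcd_add_mult mult.commute add.commute)

text \<open>Replacing r by r + c t translates w by t and does not change the inverse modulo c. A
  residue class therefore contributes the unit pieces of one and the same line integral.\<close>

lemma summand_coeff_residue_class: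
  assumes "c > 0" "coprime c r"
  shows "summand_coeff k m n c (r + c * t) = add_char c (int m * modular_inverse c r + int n * r) / of_int c ^ k *
     integral {0..1} (\<lambda>x. line_kernel k m n c (of_real (x + of_int t) + of_real (of_int r / of_int c) + \<i>))"
proof -
  define A where "A = add_char c (int m * modular_inverse c r + int n * r) / of_int c ^ k"
  have "coprime c (r + c * t)"
    using assms(2) by (simp add: coprime_add_mult_self_iff)
  then have "[modular_inverse c (r + c * t) * (r + c * t) = 1] (mod c)"
    by (intro cong_modular_inverse2) (simp add: coprime_commute)
  moreover have "[modular_inverse c (r + c * t) * (r + c * t) = modular_inverse c (r + c * t) * r] (mod c)"
    by (intro cong_mult cong_refl) (simp add: cong_def)
  ultimately have "[modular_inverse c (r + c * t) * r = 1] (mod c)"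
    by (simp add: cong_def)
  then have char: "add_char c (int m * modular_inverse c (r + c * t)) = add_char c (int m * modular_inverse c r)"
    by (rule add_char_inverse_cong[OF assms(2)])
  have "poincare_summand k m c (r + c * t) z * e (- of_nat n * z) = A * line_kernel k m n c (z + of_int t + of_real (of_int r / of_int c))"
    if "Im z > 0" for z
  proof -
    obtain w where w: "w = z + of_int t + of_real (of_int r / of_int c)" by blast
    have "Im w = Im z" by (simp add: w)
    then have "w \<noteq> 0" using that by auto
    have cw: "of_int c * z + of_int (r + c * t) = of_int c * w"
      using assms by (simp add: w algebra_simps)
    \<comment> \<open>Undoing the shift by r / c creates the phase n r of the Kloosterman sum; the
      integer shift t leaves none.\<close>
    have "- of_nat n * z = - of_nat n * w + (of_int (int n * t) + of_int (int n * r) / of_int c)"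
      by (simp add: w algebra_simps)
    then have "e (- of_nat n * z) = e (- of_nat n * w) * add_char c (int n * r)"
      by (simp only: e_add e_of_int add_char_def mult_1_left)
    moreover have "e (- (of_nat m / (of_int c * (of_int c * w)))) * e (- of_nat n * w) =
        exp (- \<i> * of_real (2 * pi * m / (of_int c)\<^sup>2) / w + - \<i> * of_real (2 * pi * n) * w)"
      unfolding exp_add by (rule arg_cong2[of _ _ _ _ "(*)"]) (simp_all add: e_def power2_eq_square mult_ac)
    ultimately show ?thesis
      unfolding w[symmetric] poincare_summand_def cw char A_def line_kernel_def
      using assms by (simp add: add_char_add power_mult_distrib mult_ac)
  qed
  from this[of "of_real x + \<i>" for x]
  have "poincare_summand k m c (r + c * t) (of_real x + \<i>) * e (- of_nat n * (of_real x + \<i>)) =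
      A * line_kernel k m n c (of_real (x + of_int t) + of_real (of_int r / of_int c) + \<i>)" for x
    by (simp add: add_ac)
  then show ?thesis
    by (simp only: summand_coeff_def fourier_coeff_def integral_mult_right flip: A_def)
qed

text \<open>The unit pieces fill the whole line at height 1, so the closed form applies with
  \<alpha> = 2 pi m / c^2, \<beta> = 2 pi n, s = r / c and order k - 1; \<alpha> \<beta> is the
  Bessel argument.\<close>

lemma infsum_summand_coeff_residue_class:
  assumes "c > 0" "coprime c r" "k \<ge> 4"
  shows "(\<Sum>\<^sub>\<infinity>t. summand_coeff k m n c (r + c * t)) =
    add_char c (int m * modular_inverse c r + int n * r) / of_int c ^ k *
    - (2 * pi * \<i> * ((- \<i> * of_real (2 * pi * n)) ^ (k - 1) *
         of_real (bessel_clifford (k - 1) (4 * pi\<^sup>2 * m * n / (of_int c)\<^sup>2))))"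
proof (rule infsum_int_eq_limit)
  let ?A = "add_char c (int m * modular_inverse c r + int n * r) / of_int c ^ k"
  let ?h = "\<lambda>x. line_kernel k m n c (of_real x + of_real (of_int r / of_int c) + \<i>)"
  have inj: "inj (\<lambda>t. (c, r + c * t))" using assms by (auto simp: inj_on_def)
  have "range (\<lambda>t. (c, r + c * t)) \<subseteq> {(c, d). coprime c d}"
    using assms(2) by (auto simp: coprime_add_mult_self_iff)
  then have "(\<lambda>(c, d). summand_coeff k m n c d) summable_on range (\<lambda>t. (c, r + c * t))"
    by (rule summable_on_subset_banach[OF summable_on_summand_coeff[OF assms(3)]])
  then show "(\<lambda>t. summand_coeff k m n c (r + c * t)) summable_on UNIV"
    by (simp add: summable_on_reindex[OF inj] o_def)
  have cont: "continuous_on UNIV ?h"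
  proof -
    have "of_real x + of_real (of_int r / of_int c) + \<i> \<noteq> 0" for x
      by (simp add: complex_eq_iff)
    then show ?thesis
      unfolding line_kernel_def by (intro continuous_intros) auto
  qed
  have "(\<lambda>T. integral {- real T..real T} ?h) \<longlonglongrightarrow>
      - (2 * pi * \<i> * ((- \<i> * of_real (2 * pi * n)) ^ (k - 1) *
         of_real (bessel_clifford (k - 1) (2 * pi * m / (of_int c)\<^sup>2 * (2 * pi * n)))))"
    using horizontal_line_integral_exp[of "2 * pi * m / (of_int c)\<^sup>2" "2 * pi * n" "k - 1" "of_int r / of_int c"] assms
    by (simp add: line_kernel_def)
  also have "2 * pi * m / (of_int c)\<^sup>2 * (2 * pi * n) = 4 * pi\<^sup>2 * m * n / (of_int c)\<^sup>2"
    by (simp add: power2_eq_square)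
  finally have "(\<lambda>T. ?A * integral {- real T..real T} ?h) \<longlonglongrightarrow> ?A *
      - (2 * pi * \<i> * ((- \<i> * of_real (2 * pi * n)) ^ (k - 1) *
         of_real (bessel_clifford (k - 1) (4 * pi\<^sup>2 * m * n / (of_int c)\<^sup>2))))"
    by (intro tendsto_mult tendsto_const)
  moreover have "(\<Sum>t\<in>{- int T..<int T}. summand_coeff k m n c (r + c * t)) = ?A * integral {- real T..real T} ?h" for T
    unfolding sum_integral_unit_intervals[OF cont, symmetric] sum_distrib_left
    using assms by (intro sum.cong refl summand_coeff_residue_class)
  ultimately show "(\<lambda>T. \<Sum>t\<in>{- int T..<int T}. summand_coeff k m n c (r + c * t)) \<longlonglongrightarrow> ?A *
      - (2 * pi * \<i> * ((- \<i> * of_real (2 * pi * n)) ^ (k - 1) *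
         of_real (bessel_clifford (k - 1) (4 * pi\<^sup>2 * m * n / (of_int c)\<^sup>2))))"
    by simp
qed

text \<open>The Bessel factor is the same for every residue class of d, so only the roots of unity
  are summed, and they form the Kloosterman sum.\<close>

lemma infsum_summand_coeff_fixed_c:
  assumes "c > 0" "k \<ge> 4"
  shows "(\<Sum>\<^sub>\<infinity>d\<in>{d. coprime c d}. summand_coeff k m n c d) =
    - (2 * pi * \<i> * (- \<i> * of_real (2 * pi * n)) ^ (k - 1)) *
    (kloosterman m n c / of_int c ^ k * of_real (bessel_clifford (k - 1) (4 * pi\<^sup>2 * m * n / (of_int c)\<^sup>2)))"
proof -
  let ?U = "{r\<in>{0..<c}. coprime r c}"
  let ?K = "- (2 * pi * \<i> * ((- \<i> * of_real (2 * pi * n)) ^ (k - 1) *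
         of_real (bessel_clifford (k - 1) (4 * pi\<^sup>2 * m * n / (of_int c)\<^sup>2)))) :: complex"
  let ?f = "\<lambda>d. summand_coeff k m n c d"
  have bij: "bij_betw (\<lambda>(r, t). r + c * t) (?U \<times> UNIV) {d. coprime c d}"
  proof (rule bij_betw_byWitness[where f' = "\<lambda>d. (d mod c, d div c)"])
    show "(\<lambda>(r, t). r + c * t) ` (?U \<times> UNIV) \<subseteq> {d. coprime c d}"
      by (auto simp: coprime_add_mult_self_iff intro: coprime_commute[THEN iffD1])
    show "(\<lambda>d. (d mod c, d div c)) ` {d. coprime c d} \<subseteq> ?U \<times> UNIV"
      using assms by (auto simp: coprime_mod_left_iff coprime_commute)
  qed (use assms in auto)
  have "?f summable_on {d. coprime c d}"
  proof -
    have "(\<lambda>(c, d). summand_coeff k m n c d) summable_on Pair c ` {d. coprime c d}"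
      by (rule summable_on_subset_banach[OF summable_on_summand_coeff[OF assms(2)]]) auto
    then show ?thesis by (subst (asm) summable_on_reindex) (auto simp: o_def inj_on_def)
  qed
  then have sm: "(\<lambda>(r, t). ?f (r + c * t)) summable_on ?U \<times> UNIV"
    using summable_on_reindex_bij_betw[OF bij, of ?f] by (simp add: case_prod_unfold)
  have "infsum ?f {d. coprime c d} = (\<Sum>\<^sub>\<infinity>(r, t)\<in>?U \<times> UNIV. ?f (r + c * t))"
    using infsum_reindex_bij_betw[OF bij, of ?f] by (simp add: case_prod_unfold)
  also have "\<dots> = (\<Sum>\<^sub>\<infinity>r\<in>?U. \<Sum>\<^sub>\<infinity>t. ?f (r + c * t))"
    using infsum_Sigma_banach[OF sm] by simp
  also have "\<dots> = (\<Sum>r\<in>?U. \<Sum>\<^sub>\<infinity>t. ?f (r + c * t))"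
    by (rule infsum_finite) (rule finite_subset[of _ "{0..<c}"], auto)
  also have "\<dots> = (\<Sum>r\<in>?U. add_char c (int m * modular_inverse c r + int n * r) / of_int c ^ k * ?K)"
    using assms by (intro sum.cong refl infsum_summand_coeff_residue_class) (auto simp: coprime_commute)
  also have "\<dots> = kloosterman m n c / of_int c ^ k * ?K"
    by (simp only: kloosterman_def sum_distrib_right sum_divide_distrib)
  finally show ?thesis by (simp add: mult_ac)
qed

subsection \<open>Nonvanishing\<close>

text \<open>The factor 2 counts the distinct cosets of (c, d) and (-c, -d), and c = 0 drops out by
  orthogonality. Absolute convergence allows d to be summed first and the moduli to be listed in
  increasing order, so that the first one can be split off.\<close>

lemma fourier_coeff_poincare:
  assumes "k \<ge> 4" "even k" "m \<noteq> n" "N > 0"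
  shows "(\<lambda>j::nat. 2 * (- (2 * pi * \<i> * (- \<i> * of_real (2 * pi * n)) ^ (k - 1))) *
      (kloosterman m n (int (Suc j) * int N) / of_nat (Suc j * N) ^ k *
       of_real (bessel_clifford (k - 1) (4 * pi\<^sup>2 * m * n / (real (Suc j * N))\<^sup>2))))
    sums fourier_coeff (poincare k m N) n"
proof -
  let ?Q = "bottom_rows N"
  let ?f = "\<lambda>(c, d). summand_coeff k m n c d"
  let ?C = "{c. c > 0 \<and> int N dvd c}"
  define Q0 Qp Qm where "Q0 = {(c, d). (c, d) \<in> ?Q \<and> c = 0}" and "Qp = {(c, d). (c, d) \<in> ?Q \<and> c > 0}"
    and "Qm = {(c, d). (c, d) \<in> ?Q \<and> c < 0}"
  have sm: "?f summable_on X" if "X \<subseteq> ?Q" for X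
    using that by (intro summable_on_subset_banach[OF summable_on_summand_coeff[OF assms(1)]])
      (auto simp: bottom_rows_def)
  have sub: "Q0 \<subseteq> ?Q" "Qp \<subseteq> ?Q" "Qm \<subseteq> ?Q"
    by (auto simp: Q0_def Qp_def Qm_def)
  have Q: "?Q = Q0 \<union> (Qp \<union> Qm)"
    by (auto simp: Q0_def Qp_def Qm_def)
  have "infsum ?f (Qp \<union> Qm) = infsum ?f Qp + infsum ?f Qm"
    using sub by (intro infsum_Un_disjoint sm) (auto simp: Qp_def Qm_def)
  moreover have "infsum ?f ?Q = infsum ?f Q0 + infsum ?f (Qp \<union> Qm)"
    unfolding Q using sub by (intro infsum_Un_disjoint sm) (auto simp: Q0_def Qp_def Qm_def)
  moreover have "infsum ?f Q0 = 0"
    using assms(3) by (intro infsum_0) (auto simp: Q0_def summand_coeff_0)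
  moreover have "infsum ?f Qm = infsum ?f Qp"
  proof (rule infsum_reindex_bij_witness[of _ "\<lambda>(c, d). (- c, - d)" "\<lambda>(c, d). (- c, - d)"])
    fix q assume "q \<in> Qm"
    then obtain c d where q: "q = (c, d)" "coprime c d" by (auto simp: Qm_def bottom_rows_def)
    have "poincare_summand k m (- c) (- d) = poincare_summand k m c d"
      using poincare_summand_uminus[OF assms(2) q(2)] by blast
    then show "?f (case q of (c, d) \<Rightarrow> (- c, - d)) = ?f q"
      by (simp add: q summand_coeff_def)
  qed (auto simp: Qm_def Qp_def bottom_rows_def)
  moreover have "infsum ?f ?Q = fourier_coeff (poincare k m N) n"
    by (rule infsumI) (rule has_sum_summand_coeff[OF assms(1,2)])
  ultimately have p: "fourier_coeff (poincare k m N) n = 2 * infsum ?f Qp"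
    by simp
  have Qp_Sigma: "Qp = Sigma ?C (\<lambda>c. {d. coprime c d})"
    by (auto simp: Qp_def bottom_rows_def)
  define B where "B = (\<lambda>c. - (2 * pi * \<i> * (- \<i> * of_real (2 * pi * n)) ^ (k - 1)) *
    (kloosterman m n c / of_int c ^ k * of_real (bessel_clifford (k - 1) (4 * pi\<^sup>2 * m * n / (of_int c)\<^sup>2))))"
  have "(?f has_sum infsum ?f Qp) (Sigma ?C (\<lambda>c. {d. coprime c d}))"
    using has_sum_infsum[OF sm[OF sub(2)]] unfolding Qp_Sigma .
  then have "(B has_sum infsum ?f Qp) ?C"
  proof (rule has_sum_SigmaD)
    fix c assume c: "c \<in> ?C"
    have "?f summable_on (Pair c ` {d. coprime c d})"
      using c by (intro sm) (auto simp: bottom_rows_def)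
    then have "(\<lambda>d. summand_coeff k m n c d) summable_on {d. coprime c d}"
      by (subst (asm) summable_on_reindex) (auto simp: o_def inj_on_def)
    from has_sum_infsum[OF this] show "((\<lambda>d. ?f (c, d)) has_sum B c) {d. coprime c d}"
      using c assms infsum_summand_coeff_fixed_c[of c k m n] by (simp add: B_def)
  qed
  moreover have bij: "bij_betw (\<lambda>j::nat. int (Suc j) * int N) UNIV ?C"
  proof (rule bij_betw_byWitness[where f' = "\<lambda>c. nat (c div int N) - 1"])
    show "\<forall>c\<in>?C. int (Suc (nat (c div int N) - 1)) * int N = c"
    proof
      fix c assume "c \<in> ?C"
      then obtain l where l: "c = int N * l" "c > 0" by auto
      then have "l > 0" using \<open>N > 0\<close> by (simp add: zero_less_mult_iff)
      then show "int (Suc (nat (c div int N) - 1)) * int N = c"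
        using l \<open>N > 0\<close> by simp
    qed
  qed (use \<open>N > 0\<close> in \<open>auto simp: nat_add_distrib\<close>)
  ultimately have "((\<lambda>j::nat. B (int (Suc j) * int N)) has_sum infsum ?f Qp) UNIV"
    by (simp only: has_sum_reindex_bij_betw[OF bij, of B])
  then have "(\<lambda>j. B (int (Suc j) * int N)) sums infsum ?f Qp"
    by (rule has_sum_imp_sums)
  from sums_mult[OF this, of 2] show ?thesis
    unfolding p B_def by (simp only: of_int_mult of_int_of_nat_eq of_nat_mult mult.assoc)
qed

section \<open>Comparison of the first modulus with all the others\<close>

lemma geometric_tail_less_exp:
  assumes "\<nu> \<ge> 26"
  shows "2 * (1 / 2) ^ (\<nu> - 2) < exp (- 3/20 * real \<nu>)"
proof -
  \<comment> \<open>Only log 2 > 1/2, that is e < 4, is used: decay at rate 1/2 against 3/20 leaves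
    room for the offset 3 in the exponent.\<close>
  have "exp (1/2 :: real) ^ 2 = exp 1" by (simp flip: exp_of_nat_mult)
  also have "\<dots> < 2 ^ 2" using exp_le by simp
  finally have "exp (1/2 :: real) < 2" by (rule power_less_imp_less_base) simp
  then have half: "1/2 < exp (- (1/2) :: real)" by (simp add: exp_minus field_simps)
  have "2 * (1 / 2) ^ (\<nu> - 2) = (1 / 2 :: real) ^ (\<nu> - 3)"
    using assms by (simp add: power_diff field_simps)
  also have "\<dots> < exp (- (1/2)) ^ (\<nu> - 3)"
    using half assms by (intro power_strict_mono) auto
  also have "\<dots> = exp (real (\<nu> - 3) * - (1/2))" by (simp only: exp_of_nat_mult)
  also have "\<dots> \<le> exp (- 3/20 * real \<nu>)" using assms by (simp add: of_nat_diff)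
  finally show ?thesis .
qed

text \<open>All bases are at least 2, so \<nu> - 2 of the factors are bounded by 1/2 and the
  remaining squares sum to pi^2 / 6 - 1, which is below 2 because pi < 4.\<close>

lemma sums_inverse_power_tail:
  assumes "\<nu> \<ge> 2"
  shows "summable (\<lambda>j. 1 / real (Suc (Suc j)) ^ \<nu>)"
    and "(\<Sum>j. 1 / real (Suc (Suc j)) ^ \<nu>) \<le> 2 * (1 / 2) ^ (\<nu> - 2)"
proof -
  have "(\<lambda>j. 1 / real (Suc (Suc j)) ^ 2) sums (pi\<^sup>2 / 6 - 1)"
    using inverse_squares_sums by (subst sums_Suc_iff[of "\<lambda>j. 1 / real (Suc j) ^ 2"]) (simp add: add.commute)
  from sums_mult[OF this, of "(1/2) ^ (\<nu> - 2)"]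
  have s: "(\<lambda>j. (1/2) ^ (\<nu> - 2) * (1 / real (Suc (Suc j)) ^ 2)) sums ((1/2) ^ (\<nu> - 2) * (pi\<^sup>2 / 6 - 1))" .
  have le: "1 / real (Suc (Suc j)) ^ \<nu> \<le> (1/2) ^ (\<nu> - 2) * (1 / real (Suc (Suc j)) ^ 2)" for j
  proof -
    have "real (Suc (Suc j)) ^ \<nu> = real (Suc (Suc j)) ^ (\<nu> - 2) * real (Suc (Suc j)) ^ 2"
      using assms by (metis le_add_diff_inverse2 power_add)
    then have "1 / real (Suc (Suc j)) ^ \<nu> = (1 / real (Suc (Suc j))) ^ (\<nu> - 2) * (1 / real (Suc (Suc j)) ^ 2)"
      by (simp add: power_divide del: of_nat_Suc)
    also have "\<dots> \<le> (1/2) ^ (\<nu> - 2) * (1 / real (Suc (Suc j)) ^ 2)"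
      by (intro mult_right_mono power_mono divide_left_mono) auto
    finally show ?thesis .
  qed
  show sm: "summable (\<lambda>j. 1 / real (Suc (Suc j)) ^ \<nu>)"
    by (rule summable_comparison_test'[OF sums_summable[OF s]]) (use le in simp)
  have "(\<Sum>j. 1 / real (Suc (Suc j)) ^ \<nu>) \<le> (1/2) ^ (\<nu> - 2) * (pi\<^sup>2 / 6 - 1)"
    using suminf_le[OF le sm sums_summable[OF s]] s by (simp add: sums_iff)
  also have "pi\<^sup>2 < 4\<^sup>2" using pi_less_4 by (intro power_strict_mono) auto
  then have "(1/2) ^ (\<nu> - 2) * (pi\<^sup>2 / 6 - 1) \<le> (1/2) ^ (\<nu> - 2) * 2"
    by (intro mult_left_mono) auto
  finally show "(\<Sum>j. 1 / real (Suc (Suc j)) ^ \<nu>) \<le> 2 * (1 / 2) ^ (\<nu> - 2)" by simp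
qed

text \<open>If the coefficient vanished, the term of modulus N would equal minus the sum of the
  others. Both sides are measured in units of N^(-k) / \<nu>!: the first is at least exp (-3/20
  \<nu>), the others together are smaller.\<close>

lemma fourier_coeff_poincare_nonzero:
  fixes N k m h :: nat
  assumes "squarefree N" "coprime m N" "even k" "k \<ge> 27" "h > 0" "m \<noteq> h * N"
    and le: "4 * pi\<^sup>2 * m * h / N \<le> (real k - 1)\<^sup>2 / 8"
  shows "fourier_coeff (poincare k m N) (h * N) \<noteq> 0"
proof
  assume zero: "fourier_coeff (poincare k m N) (h * N) = 0"
  have "N > 0" using assms by (auto intro: Nat.gr0I)
  define \<nu> where "\<nu> = k - 1"
  have k: "k = Suc \<nu>" using assms by (simp add: \<nu>_def)
  have "\<nu> \<ge> 26" using assms by (simp add: \<nu>_def)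
  define T where "T = 4 * pi\<^sup>2 * m * h / N"
  have T: "0 \<le> T" "T \<le> (real \<nu>)\<^sup>2 / 8"
    using le by (simp_all add: T_def k)
  define K where "K = 2 * (- (2 * pi * \<i> * (- \<i> * of_real (2 * pi * real (h * N))) ^ (k - 1)))"
  have "K \<noteq> 0" using assms \<open>N > 0\<close> by (simp add: K_def)
  define a where "a = (\<lambda>j. kloosterman m (int h * int N) (int (Suc j) * int N) / of_nat (Suc j * N) ^ k *
       of_real (bessel_clifford \<nu> (T / (real (Suc j))\<^sup>2)) :: complex)"
  \<comment> \<open>One factor N of n = h N cancels, so j enters only through T / j^2, and the range
    of validity at j = 1 covers all j.\<close>
  have "4 * pi\<^sup>2 * m * (h * N) / (real (Suc j * N))\<^sup>2 = T / (real (Suc j))\<^sup>2" for j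
  proof -
    have "x * (y * v) / (u * v)\<^sup>2 = x * y / v / u\<^sup>2" if "v \<noteq> 0" for x y u v :: real
      using that by (cases "u = 0") (simp_all add: power2_eq_square field_simps)
    then show ?thesis
      using \<open>N > 0\<close> unfolding T_def of_nat_mult by simp
  qed
  then have "(\<lambda>j. K * a j) sums fourier_coeff (poincare k m N) (h * N)"
    using fourier_coeff_poincare[of k m "h * N" N] assms \<open>N > 0\<close>
    by (simp only: K_def a_def \<nu>_def of_nat_mult) simp
  then have "a sums 0"
    using \<open>K \<noteq> 0\<close> sums_mult_iff[of K a 0] by (simp add: zero)
  then have tail: "(\<lambda>j. a (Suc j)) sums (- a 0)"
    by (subst sums_Suc_iff) simp
  define A where "A = 1 / (real N ^ k * fact \<nu>)"
  have "A > 0" using \<open>N > 0\<close> by (simp add: A_def)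
  have "norm (a (Suc j)) \<le> A * (1 / real (Suc (Suc j)) ^ \<nu>)" for j
  proof -
    let ?j = "real (Suc (Suc j))"
    have Tj: "0 \<le> T / ?j\<^sup>2" "T / ?j\<^sup>2 \<le> (real \<nu>)\<^sup>2 / 8"
    proof -
      have "T / ?j\<^sup>2 \<le> T / 1" using T by (intro divide_left_mono) auto
      also have "T / 1 \<le> (real \<nu>)\<^sup>2 / 8" using T by simp
      finally show "T / ?j\<^sup>2 \<le> (real \<nu>)\<^sup>2 / 8" .
    qed (use T in simp)
    have "\<bar>bessel_clifford \<nu> (T / ?j\<^sup>2)\<bar> \<le> 1 / fact \<nu>"
      using bessel_clifford_bounds(1)[OF Tj] bessel_clifford_ratio[OF Tj] by simp
    moreover have "norm (kloosterman m (int h * int N) (int (Suc (Suc j)) * int N)) \<le> ?j"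
      using norm_kloosterman_level_le[OF assms(1,2), of "int (Suc (Suc j))" "int h"] by simp
    \<comment> \<open>The Kloosterman bound j lowers the exponent of j from k to \<nu> = k -
      1.\<close>
    ultimately have "norm (a (Suc j)) \<le> ?j / (?j * N) ^ k * (1 / fact \<nu>)"
      unfolding a_def norm_mult norm_divide norm_power norm_of_real norm_of_nat of_nat_mult
      by (intro mult_mono divide_right_mono) auto
    also have "\<dots> = A * (1 / ?j ^ \<nu>)"
      by (simp add: A_def k power_mult_distrib del: of_nat_Suc)
    finally show ?thesis .
  qed
  then have "norm (\<Sum>j. a (Suc j)) \<le> (\<Sum>j. A * (1 / real (Suc (Suc j)) ^ \<nu>))"
    using \<open>\<nu> \<ge> 26\<close> by (intro norm_suminf_le summable_mult sums_inverse_power_tail) auto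
  also have "\<dots> = A * (\<Sum>j. 1 / real (Suc (Suc j)) ^ \<nu>)"
    using \<open>\<nu> \<ge> 26\<close> by (intro suminf_mult sums_inverse_power_tail) auto
  also have "\<dots> \<le> A * (2 * (1 / 2) ^ (\<nu> - 2))"
    using \<open>\<nu> \<ge> 26\<close> \<open>A > 0\<close> by (intro mult_left_mono sums_inverse_power_tail) auto
  also have "\<dots> < A * exp (- 3/20 * real \<nu>)"
    using geometric_tail_less_exp[OF \<open>\<nu> \<ge> 26\<close>] \<open>A > 0\<close> by simp
  also have "\<dots> = 1 / real N ^ k * (exp (- 3/20 * real \<nu>) / fact \<nu>)"
    by (simp add: A_def)
  also have "\<dots> \<le> 1 / real N ^ k * bessel_clifford \<nu> T"
    by (intro mult_left_mono bessel_clifford_bounds(2) T) auto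
  also have "\<dots> = norm (a 0)"
    using norm_kloosterman_level_1[OF assms(1,2), of "int h"] bessel_clifford_ratio[OF T]
    by (simp add: a_def norm_mult norm_divide norm_power)
  also have "norm (a 0) = norm (\<Sum>j. a (Suc j))"
    using tail by (simp add: sums_iff)
  finally show False by simp
qed

theorem theorem5:
  shows "\<exists>C::real. C > 0 \<and>
    (\<forall>N k m :: nat. N > 0 \<longrightarrow> squarefree N \<longrightarrow> even k \<longrightarrow>
        real k \<ge> C * max 1 (real (omega N)) \<longrightarrow>
        1 \<le> m \<longrightarrow> real m \<le> real N * (real k - 1)^2 / (32 * pi^2) \<longrightarrow>
        coprime m N \<longrightarrow>
        (\<exists>n. 1 \<le> n \<and> fourier_coeff (poincare k m N) n \<noteq> 0) \<and>
        v_inf (poincare k m N) \<le> 2 * N \<and>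
        (\<exists>z. Im z > 0 \<and> poincare k m N z \<noteq> 0))"
proof (intro exI[of _ "33 :: real"] conjI allI impI)
  fix N k m :: nat
  assume N: "N > 0" "squarefree N" and "even k" and k: "real k \<ge> 33 * max 1 (real (omega N))"
    and m: "1 \<le> m" "real m \<le> real N * (real k - 1)^2 / (32 * pi^2)" "coprime m N"
  have "33 * max 1 (real (omega N)) \<ge> 33" by simp
  then have "k \<ge> 33" using k by linarith
  \<comment> \<open>The index h N must differ from m. With h = 1 a clash means m = N, which
    coprimality permits only for N = m = 1.\<close>
  define h :: nat where "h = (if N = 1 \<and> m = 1 then 2 else 1)"
  define n where "n = h * N"
  have n: "1 \<le> n" "n \<le> 2 * N" using N by (auto simp: n_def h_def)
  have "fourier_coeff (poincare k m N) n \<noteq> 0"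
    unfolding n_def
  proof (rule fourier_coeff_poincare_nonzero)
    show "m \<noteq> h * N" using m N by (auto simp: h_def)
    show "4 * pi\<^sup>2 * real m * real h / real N \<le> (real k - 1)\<^sup>2 / 8"
    proof (cases "N = 1 \<and> m = 1")
      \<comment> \<open>Here the left side is 8 pi^2 < 8 * 16 = 128 = 32^2 / 8; this is where the
        constant 33 comes from.\<close>
      case True
      have "pi\<^sup>2 < 4\<^sup>2" using pi_less_4 by (intro power_strict_mono) auto
      moreover have "(32::real)\<^sup>2 \<le> (real k - 1)\<^sup>2" using \<open>k \<ge> 33\<close> by (intro power_mono) auto
      ultimately show ?thesis using True by (simp add: h_def)
    next
      case False
      have "real m * (32 * pi\<^sup>2) \<le> real N * (real k - 1)\<^sup>2"
        using m(2) by (simp add: pos_le_divide_eq)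
      moreover have "h = 1" using False by (auto simp: h_def)
      ultimately show ?thesis using N by (simp add: field_simps)
    qed
  qed (use N m \<open>even k\<close> \<open>k \<ge> 33\<close> in \<open>auto simp: h_def\<close>)
  then show "\<exists>n. 1 \<le> n \<and> fourier_coeff (poincare k m N) n \<noteq> 0"
    and "v_inf (poincare k m N) \<le> 2 * N"
    using n unfolding v_inf_def by (auto intro: Least_le[THEN order_trans])
  show "\<exists>z. Im z > 0 \<and> poincare k m N z \<noteq> 0"
  proof (rule ccontr)
    assume "\<not> ?thesis"
    then have "poincare k m N (of_real x + \<i>) = 0" for x by force
    then have "fourier_coeff (poincare k m N) n = 0" by (simp add: fourier_coeff_def)
    then show False using \<open>fourier_coeff (poincare k m N) n \<noteq> 0\<close> by simp
  qed
qed simp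

end
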